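(* Let $m\geq 1$, $b\geq 2$ be integers, let $W_1,\ldots,W_m\subseteq\{0,1,\ldots,b-1\}$ with $|W_i|\geq 2$, and let $K=C_{b,W_1}\times\cdots\times C_{b,W_m}$ with $\dim(K)=\sum_{i=1}^m\log|W_i|/\log b$. (i) Assume $0\in W_i$ for all $1\leq i\leq m$. Then for every $w\in[0,1)$, \[ \dim_P(\mathcal{S}^{\ast}_K(w))\geq\dim_P(\mathcal{S}^{(b)\ast}_K(w))\geq(1-w)\dim(K)=(1-w)\frac{\sum_{i=1}^m\log|W_i|}{\log b}>0, \] and in particular \[ \dim_P(\mathcal{S}^{\ast}_K(1/m))\geq\dim_P(\mathcal{S}^{(b)\ast}_K(1/m))\geq\Big(1-\frac{1}{m}\Big)\frac{\sum_{i=1}^m\log|W_i|}{\log b}. \] For arbitrary $W_i$ (not necessarily containing $0$) one still has $\dim_P(\mathcal{S}^{\ast}_K(w))\geq(1-w)\dim(K)>0$ for every $w\in[0,1)$. (ii) Assume $0\in W_i$ for all $1\leq i\leq m$. Let $w\in(0,1)$ and $w'=(1-\sqrt{w})^2$. Then for any $w_0\in[0,w)$ and $w_1\in[0,w')$, the sets $(\mathcal{S}^{\ast}_K(w_0)+\mathcal{S}^{\ast}_K(w_1))\cap K$ and $(\mathcal{S}^{(b)\ast}_K(w_0)+\mathcal{S}^{(b)\ast}_K(w_1))\cap K$ have full $\mu$-measure, and \[ \mathcal{S}_K(w_0)+\mathcal{S}_K(w_1)\supseteq\mathcal{S}^{(b)}_K(w_0)+\mathcal{S}^{(b)}_K(w_1)\supseteq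 K . \]
   Context: For an integer $b\geq 2$ and $W\subseteq\{0,\ldots,b-1\}$ with $|W|\geq 2$, $C_{b,W}$ is the set of reals $\sum_{i\geq 1}a_ib^{-i}$ with all $a_i\in W$; $\mu_{b,W}$ is its natural probability measure (the normalized restriction of the $(\log|W|/\log b)$-dimensional Hausdorff measure), and $\mu=\mu_{b,W_1}\times\cdots\times\mu_{b,W_m}$ on $K$. Fix a norm $\Vert\cdot\Vert$ on $\mathbb{R}^m$. For $w\geq 0$, $\mathcal{S}_m(w)$ is the set of $\underline{x}\in\mathbb{R}^m$ such that for every $c>0$ and all sufficiently large $Q$ the system $1\leq q\leq Q$, $\Vert q\underline{x}-\underline{p}\Vert\leq cQ^{-w}$ has an integer solution $(q,\underline{p})$; $\mathcal{S}^{(b)}_m(w)$ is the same with $q$ restricted to powers $b^N$, $N$ a positive integer. A vector $(\xi_1,\ldots,\xi_m)$ is totally irrational if $1,\xi_1,\ldots,\xi_m$ are $\mathbb{Q}$-linearly independent; $\mathcal{S}^{\ast}_m(w),\mathcal{S}^{(b)\ast}_m(w)$ are the totally irrational elements of $\mathcal{S}_m(w),\mathcal{S}^{(b)}_m(w)$. Set $\mathcal{S}_K(w)=\mathcal{S}_m(w)\cap K$, $\mathcal{S}^{(b)}_K(w)=\mathcal{S}^{(b)}_m(w)\cap K$, $\mathcal{S}^{\ast}_K(w)=\mathcal{S}^{\ast}_m(w)\cap K$, $\mathcal{S}^{(b)\ast}_K(w)=\mathcal{S}^{(b)\ast}_m(w)\cap K$. $\dim_P$ is packing dimension. *)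

theory Defs
  imports "HOL-Analysis.Analysis" "HOL-Library.Set_Algebras"
begin

subsection \<open>Hausdorff measure and dimension\<close>

(* (diam U)^s with the conventions (diam {})^s = 0 and (diam U)^0 = 1 for U nonempty;
   the explicit case s = 0 is needed because 0 powr 0 = 0 in HOL. *)
definition diam_pow :: "real \<Rightarrow> 'a::metric_space set \<Rightarrow> ennreal" where
  "diam_pow s U = (if U = {} then 0 else if s = 0 then 1 else ennreal (diameter U powr s))"

(* diameter is a junk value on unbounded sets, hence the boundedness condition. *)
definition hausdorff_pre :: "real \<Rightarrow> real \<Rightarrow> 'a::metric_space set \<Rightarrow> ennreal" where
  "hausdorff_pre s \<delta> A =
     (INF U \<in> {U :: nat \<Rightarrow> 'a set. A \<subseteq> (\<Union>i. U i) \<and> (\<forall>i. bounded (U i) \<and> diameter (U i) \<le> \<delta>)}.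
        \<Sum>i. diam_pow s (U i))"

definition hausdorff_outer :: "real \<Rightarrow> 'a::metric_space set \<Rightarrow> ennreal" where
  "hausdorff_outer s A = (SUP \<delta> \<in> {0<..}. hausdorff_pre s \<delta> A)"

definition hausdorff_measure :: "real \<Rightarrow> 'a::metric_space measure" where
  "hausdorff_measure s = measure_of UNIV (sets borel) (hausdorff_outer s)"

definition hausdorff_dim :: "'a::metric_space set \<Rightarrow> ereal" where
  "hausdorff_dim A = Inf {ereal s |s. 0 \<le> s \<and> hausdorff_outer s A = 0}"

subsection \<open>Packing measure and dimension\<close>

(* A \<delta>-packing of A is a countable family of pairwise disjoint closed balls with centres in A
   and radii in (0, \<delta>], encoded as the set of its pairs (centre, radius). *)
definition delta_packing :: "real \<Rightarrow> 'a::metric_space set \<Rightarrow> ('a \<times> real) set \<Rightarrow> bool" where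
  "delta_packing \<delta> A P \<longleftrightarrow>
     countable P \<and> (\<forall>(x, r)\<in>P. x \<in> A \<and> 0 < r \<and> r \<le> \<delta>) \<and>
     disjoint_family_on (\<lambda>(x, r). cball x r) P"

definition packing_pre :: "real \<Rightarrow> 'a::metric_space set \<Rightarrow> ennreal" where
  "packing_pre s A =
     (INF \<delta> \<in> {0<..}. SUP P \<in> {P. delta_packing \<delta> A P}.
        infsum (\<lambda>(x, r). ennreal ((2 * r) powr s)) P)"

definition packing_measure :: "real \<Rightarrow> 'a::metric_space set \<Rightarrow> ennreal" where
  "packing_measure s A =
     (INF F \<in> {F :: nat \<Rightarrow> 'a set. A \<subseteq> (\<Union>i. F i)}. \<Sum>i. packing_pre s (F i))"

definition packing_dim :: "'a::metric_space set \<Rightarrow> ereal" where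
  "packing_dim A = Inf {ereal s |s. 0 \<le> s \<and> packing_measure s A = 0}"

subsection \<open>Missing digit Cantor sets, their products and natural measures\<close>

definition cantor_set :: "nat \<Rightarrow> nat set \<Rightarrow> real set" where
  "cantor_set b W =
     {x. \<exists>a :: nat \<Rightarrow> nat. (\<forall>i. a i \<in> W) \<and> x = (\<Sum>i. real (a i) / real b ^ Suc i)}"

definition cantor_measure :: "nat \<Rightarrow> nat set \<Rightarrow> real measure" where
  "cantor_measure b W =
     uniform_measure (hausdorff_measure (ln (real (card W)) / ln (real b))) (cantor_set b W)"

definition cantor_prod :: "nat \<Rightarrow> ('m::finite \<Rightarrow> nat set) \<Rightarrow> (real ^ 'm) set" where
  "cantor_prod b W = {x. \<forall>i. x $ i \<in> cantor_set b (W i)}"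

(* The product measure on functions 'm => real, transported to real ^ 'm. *)
definition cantor_prod_measure :: "nat \<Rightarrow> ('m::finite \<Rightarrow> nat set) \<Rightarrow> (real ^ 'm) measure" where
  "cantor_prod_measure b W =
     distr (PiM UNIV (\<lambda>i. cantor_measure b (W i))) borel vec_lambda"

subsection \<open>Singular vectors\<close>

definition is_norm :: "('a::real_vector \<Rightarrow> real) \<Rightarrow> bool" where
  "is_norm N \<longleftrightarrow>
     (\<forall>x. 0 \<le> N x) \<and> (\<forall>x. N x = 0 \<longleftrightarrow> x = 0) \<and>
     (\<forall>c x. N (c *\<^sub>R x) = \<bar>c\<bar> * N x) \<and> (\<forall>x y. N (x + y) \<le> N x + N y)"

definition int_vec :: "int ^ 'm \<Rightarrow> real ^ 'm" where
  "int_vec p = (\<chi> i. of_int (p $ i))"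

(* The parameter Q ranges over the reals. *)
definition sing :: "(real ^ 'm::finite \<Rightarrow> real) \<Rightarrow> real \<Rightarrow> (real ^ 'm) set" where
  "sing N w = {x. \<forall>c>0. \<forall>\<^sub>F Q :: real in at_top. \<exists>(q :: int) (p :: int ^ 'm).
     1 \<le> q \<and> of_int q \<le> Q \<and> N (of_int q *\<^sub>R x - int_vec p) \<le> c * Q powr (- w)}"

definition sing_base :: "nat \<Rightarrow> (real ^ 'm::finite \<Rightarrow> real) \<Rightarrow> real \<Rightarrow> (real ^ 'm) set" where
  "sing_base b N w = {x. \<forall>c>0. \<forall>\<^sub>F Q :: real in at_top. \<exists>(n :: nat) (p :: int ^ 'm).
     1 \<le> n \<and> real b ^ n \<le> Q \<and> N (real b ^ n *\<^sub>R x - int_vec p) \<le> c * Q powr (- w)}"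

definition totally_irrational :: "real ^ 'm::finite \<Rightarrow> bool" where
  "totally_irrational x \<longleftrightarrow>
     (\<forall>(a0 :: rat) (a :: 'm \<Rightarrow> rat).
        of_rat a0 + (\<Sum>i\<in>UNIV. of_rat (a i) * x $ i) = (0 :: real) \<longrightarrow> a0 = 0 \<and> (\<forall>i. a i = 0))"

definition sing_star :: "(real ^ 'm::finite \<Rightarrow> real) \<Rightarrow> real \<Rightarrow> (real ^ 'm) set" where
  "sing_star N w = {x \<in> sing N w. totally_irrational x}"

definition sing_base_star :: "nat \<Rightarrow> (real ^ 'm::finite \<Rightarrow> real) \<Rightarrow> real \<Rightarrow> (real ^ 'm) set" where
  "sing_base_star b N w = {x \<in> sing_base b N w. totally_irrational x}"

end

theory Submission
  imports Defs
begin

text \<open>If all coordinates of \<open>x\<close> have the constant digit \<open>d\<^sub>i\<close> at the positions \<open>n, \<dots>, n + l - 1\<close>, then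
  \<open>q = (b - 1) b^n\<close> (or \<open>q = b^n\<close> when \<open>d = 0\<close>) approximates \<open>x\<close> with error about \<open>b^(-l)\<close>; so \<open>x\<close> is
  singular with exponent \<open>w\<close> as soon as for every large \<open>L\<close> there is such a block with \<open>n \<le> L\<close> and
  \<open>l \<ge> w' L\<close>, \<open>w' > w\<close>. Blocks starting at \<open>j!\<close> of length \<open>w' (j + 1)!\<close> leave a set of free positions
  of upper density \<open>1 - w'\<close>, and Baire's theorem together with the packing by cylinders of level \<open>j!\<close>
  gives the bound for the packing dimension. For the sumset results, the digits of \<open>x \<in> K\<close> are split between two summands
  along geometrically growing blocks, each summand being zero on the blocks of the other.
  For almost all \<open>x\<close> both summands are totally irrational by Fubini, since each fibre of the map
  keeping only the digits in one family of blocks has infinitely many disjoint translates inside the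
  Cantor set.\<close>

section \<open>Digit expansions\<close>

text \<open>Expansions in base \<open>b\<close> are not unique. Separation is therefore claimed only
  for digit sequences with a common tail, neighbouring cylinders are counted together, and the
  almost sure statement discards the rationals, outside which floors recover the digits.

  Packing dimension is defined through arbitrary countable covers, so a large premeasure of the
  whole set proves nothing. A packing tolerates small shifts of its centres, however, so a piece
  that is merely dense in a cylinder has as rich packings as the cylinder itself; Baire supplies
  such a piece in every cover. Total irrationality excludes countably many rational hyperplanes,
  each nowhere dense in the digit product and, pulled back by the coordinatewise digit projection,
  null.

  Factorial growth makes the past negligible: just before position \<open>(j + 1)!\<close> the
  constant digits fill about \<open>w' * (j + 1)!\<close> places, hence the upper density. The
  Hausdorff dimension of \<open>K\<close>, which enters the statement, is found by counting
  cylinders in a finite subcover instead of constructing a measure. Exponents are always reached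
  with a strict loss, which swallows the constants coming from the norm, from \<open>c\<close> and
  from rounding.\<close>

definition digit_val :: "nat \<Rightarrow> (nat \<Rightarrow> nat) \<Rightarrow> real" where
  "digit_val b a = (\<Sum>k. real (a k) / real b ^ Suc k)"

text \<open>The integer with base-\<open>b\<close> digits \<open>a 0, ..., a (n - 1)\<close>. For
  digits below \<open>b\<close> it is the integer part of \<open>b ^ n * digit_val b a\<close>, or
  one less if all digits from \<open>n\<close> on are \<open>b - 1\<close>.\<close>

primrec digit_pre :: "nat \<Rightarrow> (nat \<Rightarrow> nat) \<Rightarrow> nat \<Rightarrow> nat" where
  "digit_pre b a 0 = 0"
| "digit_pre b a (Suc n) = b * digit_pre b a n + a n"

lemma geometric_digit_sums:
  assumes "2 \<le> b"
  shows "(\<lambda>k. (real b - 1) / real b ^ Suc k) sums 1"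
proof -
  have "(\<lambda>k. (1 / real b) ^ Suc k) sums (1 / (1 - 1 / real b) - 1)"
    using geometric_sums[of "1 / real b"] assms
    by (subst sums_Suc_iff) auto
  from sums_mult[OF this, of "real b - 1"] assms show ?thesis
    by (simp add: field_simps power_divide)
qed

lemma digit_val_summable:
  assumes "2 \<le> b" "\<And>k. a k < b"
  shows "summable (\<lambda>k. real (a k) / real b ^ Suc k)"
proof (rule summable_comparison_test')
  show "summable (\<lambda>k. (real b - 1) / real b ^ Suc k)"
    using geometric_digit_sums[OF assms(1)] by (rule sums_summable)
  show "norm (real (a k) / real b ^ Suc k) \<le> (real b - 1) / real b ^ Suc k" if "k \<ge> 0" for k
    using assms(1) assms(2)[of k] by (auto intro!: divide_right_mono)
qed

lemma digit_val_nonneg: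
  assumes "2 \<le> b" "\<And>k. a k < b"
  shows "0 \<le> digit_val b a"
  unfolding digit_val_def by (rule suminf_nonneg[OF digit_val_summable[OF assms]]) auto

lemma digit_val_le_1:
  assumes "2 \<le> b" "\<And>k. a k < b"
  shows "digit_val b a \<le> 1"
proof -
  have "digit_val b a \<le> (\<Sum>k. (real b - 1) / real b ^ Suc k)"
    unfolding digit_val_def
  proof (rule suminf_le[OF _ digit_val_summable[OF assms]])
    show "real (a k) / real b ^ Suc k \<le> (real b - 1) / real b ^ Suc k" for k
      using assms(1) assms(2)[of k] by (auto intro!: divide_right_mono)
    show "summable (\<lambda>k. (real b - 1) / real b ^ Suc k)"
      using geometric_digit_sums[OF assms(1)] by (rule sums_summable)
  qed
  thus ?thesis using sums_unique[OF geometric_digit_sums[OF assms(1)]] by simp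
qed

lemma digit_val_const:
  assumes "2 \<le> b"
  shows "digit_val b (\<lambda>_. d) = real d / (real b - 1)"
proof -
  have "(\<lambda>k. real d / real b ^ Suc k) sums (real d / (real b - 1) * 1)"
    using sums_mult[OF geometric_digit_sums[OF assms], of "real d / (real b - 1)"] assms by simp
  thus ?thesis unfolding digit_val_def using sums_unique by fastforce
qed

lemma digit_val_zero: "digit_val b (\<lambda>_. 0) = 0"
  unfolding digit_val_def by simp

lemma digit_val_Suc:
  assumes "2 \<le> b" "\<And>k. a k < b"
  shows "real b * digit_val b a = real (a 0) + digit_val b (\<lambda>k. a (Suc k))"
proof -
  have "digit_val b a = real (a 0) / real b + (\<Sum>k. real (a (Suc k)) / real b ^ Suc (Suc k))"
    unfolding digit_val_def
    using suminf_split_head[of "\<lambda>k. real (a k) / real b ^ Suc k", OF digit_val_summable]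
      assms by simp
  moreover have "(\<Sum>k. real (a (Suc k)) / real b ^ Suc k / real b) =
      digit_val b (\<lambda>k. a (Suc k)) / real b"
    unfolding digit_val_def
    by (rule suminf_divide) (use digit_val_summable[of b "\<lambda>k. a (Suc k)"] assms in auto)
  ultimately show ?thesis using assms(1) by (simp add: field_simps)
qed

text \<open>Multiplication by \<open>b ^ n\<close> moves the radix point. Approximation with
  denominator \<open>b ^ n\<close>, separation of points and recovery of digits by floors are all
  read off from this identity.\<close>

lemma digit_val_shift:
  assumes "2 \<le> b" "\<And>k. a k < b"
  shows "real b ^ n * digit_val b a = real (digit_pre b a n) + digit_val b (\<lambda>k. a (n + k))"
proof (induction n)
  case 0
  show ?case by simp
next
  case (Suc n)
  have "real b ^ Suc n * digit_val b a = real b * (real b ^ n * digit_val b a)"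
    by simp
  also have "\<dots> = real b * real (digit_pre b a n) + real b * digit_val b (\<lambda>k. a (n + k))"
    unfolding Suc by (simp add: algebra_simps)
  also have "real b * digit_val b (\<lambda>k. a (n + k)) = real (a n) + digit_val b (\<lambda>k. a (Suc n + k))"
    using digit_val_Suc[of b "\<lambda>k. a (n + k)"] assms by simp
  finally show ?case by simp
qed

lemma digit_pre_cong:
  assumes "\<And>k. k < n \<Longrightarrow> a k = a' k"
  shows "digit_pre b a n = digit_pre b a' n"
  using assms by (induction n) auto

lemma digit_pre_inj:
  assumes "\<And>k. a k < b" "\<And>k. a' k < b" "digit_pre b a n = digit_pre b a' n" "k < n"
  shows "a k = a' k"
  using assms(3,4)
proof (induction n)
  case (Suc n)
  have "a n < b" "a' n < b" using assms by auto
  have eq: "b * digit_pre b a n + a n = b * digit_pre b a' n + a' n" using Suc by simp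
  have "(b * digit_pre b a n + a n) mod b = (b * digit_pre b a' n + a' n) mod b" using eq by simp
  hence "a n = a' n" using \<open>a n < b\<close> \<open>a' n < b\<close> by simp
  moreover have "digit_pre b a n = digit_pre b a' n" using eq calculation \<open>a n < b\<close> by simp
  ultimately show ?case using Suc by (cases "k = n") auto
qed simp

lemma digit_val_dist_le:
  assumes "2 \<le> b" "\<And>k. a k < b" "\<And>k. a' k < b" "\<And>k. k < n \<Longrightarrow> a k = a' k"
  shows "\<bar>digit_val b a - digit_val b a'\<bar> \<le> 1 / real b ^ n"
proof -
  have "real b ^ n * (digit_val b a - digit_val b a') =
      digit_val b (\<lambda>k. a (n + k)) - digit_val b (\<lambda>k. a' (n + k))"
    using digit_val_shift[of b a n] digit_val_shift[of b a' n] digit_pre_cong[of n a a' b] assms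
    by (simp add: algebra_simps)
  moreover have "\<bar>digit_val b (\<lambda>k. a (n + k)) - digit_val b (\<lambda>k. a' (n + k))\<bar> \<le> 1"
    using digit_val_nonneg[of b "\<lambda>k. a (n + k)"] digit_val_le_1[of b "\<lambda>k. a (n + k)"]
      digit_val_nonneg[of b "\<lambda>k. a' (n + k)"] digit_val_le_1[of b "\<lambda>k. a' (n + k)"] assms by fastforce
  ultimately have "real b ^ n * \<bar>digit_val b a - digit_val b a'\<bar> \<le> 1"
    by (metis abs_mult abs_of_nonneg of_nat_0_le_iff zero_le_power)
  thus ?thesis using assms(1) by (simp add: field_simps)
qed

text \<open>After scaling by \<open>b ^ n\<close> the common tails cancel and two distinct integers
  remain. Without a common tail this fails: \<open>1 0 0 ...\<close> and
  \<open>0 (b-1) (b-1) ...\<close> have the same value.\<close>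

lemma digit_val_dist_ge:
  assumes "2 \<le> b" "\<And>k. a k < b" "\<And>k. a' k < b" "\<And>k. k \<ge> n \<Longrightarrow> a k = a' k" "a \<noteq> a'"
  shows "1 / real b ^ n \<le> \<bar>digit_val b a - digit_val b a'\<bar>"
proof -
  obtain k where k: "a k \<noteq> a' k" using assms(5) by auto
  hence "k < n" using assms(4) not_less by blast
  hence "digit_pre b a n \<noteq> digit_pre b a' n" using digit_pre_inj[of a b a' n k] assms k by blast
  hence "1 \<le> \<bar>real (digit_pre b a n) - real (digit_pre b a' n)\<bar>" by linarith
  moreover have "real b ^ n * (digit_val b a - digit_val b a') =
      real (digit_pre b a n) - real (digit_pre b a' n)"
    using digit_val_shift[of b a n] digit_val_shift[of b a' n] assms
    by (simp add: algebra_simps)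
  ultimately have "1 \<le> real b ^ n * \<bar>digit_val b a - digit_val b a'\<bar>"
    by (metis abs_mult abs_of_nonneg of_nat_0_le_iff zero_le_power)
  thus ?thesis using assms(1) by (simp add: field_simps)
qed

lemma digit_pre_eq_floor:
  assumes "2 \<le> b" "\<And>k. a k < b" "digit_val b (\<lambda>k. a (n + k)) \<noteq> 1"
  shows "int (digit_pre b a n) = \<lfloor>real b ^ n * digit_val b a\<rfloor>"
proof -
  have "digit_val b (\<lambda>k. a (n + k)) < 1" "0 \<le> digit_val b (\<lambda>k. a (n + k))"
    using assms digit_val_le_1[of b "\<lambda>k. a (n + k)"] digit_val_nonneg[of b "\<lambda>k. a (n + k)"]
    by fastforce+
  thus ?thesis unfolding digit_val_shift[OF assms(1,2)] by linarith
qed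

text \<open>In \<open>b = digit + tail\<close> the digit is at most \<open>b - 1\<close> and the
  tail at most 1, so a tail of value 1 forces both to be maximal and passes the value 1 on to the
  next tail.\<close>

lemma digit_val_eq_1_iff:
  assumes "2 \<le> b" "\<And>k. a k < b" 
  shows "digit_val b a = 1 \<longleftrightarrow> (\<forall>k. a k = b - 1)"
proof
  assume v: "digit_val b a = 1"
  have shift: "digit_val b (\<lambda>k. a (n + k)) = 1" for n
  proof (induction n)
    case (Suc n)
    have "real b = real (a n) + digit_val b (\<lambda>k. a (Suc n + k))"
      using digit_val_Suc[of b "\<lambda>k. a (n + k)"] assms Suc by simp
    moreover have "digit_val b (\<lambda>k. a (Suc n + k)) \<le> 1"
      using digit_val_le_1[of b "\<lambda>k. a (Suc n + k)"] assms by blast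
    moreover have "real (a n) \<le> real b - 1" using assms(2)[of n] by linarith
    ultimately show ?case by linarith
  qed (use v in simp)
  show "\<forall>k. a k = b - 1"
  proof
    fix n
    have "real b = real (a n) + digit_val b (\<lambda>k. a (Suc n + k))"
      using digit_val_Suc[of b "\<lambda>k. a (n + k)"] assms shift[of n] by simp
    thus "a n = b - 1" using shift[of "Suc n"] assms(1) by simp
  qed
next
  assume "\<forall>k. a k = b - 1"
  hence "a = (\<lambda>_. b - 1)" by auto
  thus "digit_val b a = 1" using digit_val_const[OF assms(1), of "b - 1"] assms(1)
    by (simp add: of_nat_diff)
qed

lemma digit_val_add:
  assumes "2 \<le> b" "\<And>k. a k < b" "\<And>k. a' k < b"
  shows "digit_val b a + digit_val b a' = digit_val b (\<lambda>k. a k + a' k)"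
  unfolding digit_val_def
  by (subst suminf_add[OF digit_val_summable[OF assms(1,2)] digit_val_summable[OF assms(1,3)]])
    (simp add: add_divide_distrib)

lemma digit_val_fun_upd:
  assumes "2 \<le> b" "\<And>k. a k < b" "d < b"
  shows "digit_val b (a(k := d)) = digit_val b a + (real d - real (a k)) / real b ^ Suc k"
proof -
  have "digit_val b (a(k := d)) - digit_val b a =
      (\<Sum>j. real ((a(k := d)) j) / real b ^ Suc j - real (a j) / real b ^ Suc j)"
    unfolding digit_val_def
    by (rule suminf_diff) (use digit_val_summable[of b a] digit_val_summable[of b "a(k := d)"] assms in auto)
  also have "\<dots> = (\<Sum>j\<in>{k}. real ((a(k := d)) j) / real b ^ Suc j - real (a j) / real b ^ Suc j)"
    by (rule suminf_finite) auto
  finally show ?thesis by (simp add: diff_divide_distrib)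
qed

text \<open>The alphabet depends on the position because the singular points built later have
  prescribed digits on the blocks and free digits elsewhere.\<close>

definition digit_set :: "nat \<Rightarrow> (nat \<Rightarrow> nat set) \<Rightarrow> real set" where
  "digit_set b V = {digit_val b a |a. \<forall>k. a k \<in> V k}"

definition digit_prod :: "nat \<Rightarrow> ('m::finite \<Rightarrow> nat \<Rightarrow> nat set) \<Rightarrow> (real ^ 'm) set" where
  "digit_prod b V = {x. \<forall>i. x $ i \<in> digit_set b (V i)}"

lemma cantor_set_eq_digit_set: "cantor_set b W = digit_set b (\<lambda>_. W)"
  unfolding cantor_set_def digit_set_def digit_val_def by auto

lemma cantor_prod_eq_digit_prod: "cantor_prod b W = digit_prod b (\<lambda>i _. W i)"
  unfolding cantor_prod_def digit_prod_def cantor_set_eq_digit_set by auto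

lemma digit_prodE:
  assumes "x \<in> digit_prod b V"
  obtains a where "\<And>i k. a i k \<in> V i k" "\<And>i. x $ i = digit_val b (a i)"
proof -
  have "\<forall>i. \<exists>a. (\<forall>k. a k \<in> V i k) \<and> x $ i = digit_val b a"
    using assms unfolding digit_prod_def digit_set_def by blast
  then obtain a where "\<forall>i. (\<forall>k. a i k \<in> V i k) \<and> x $ i = digit_val b (a i)" by metis
  thus ?thesis using that by blast
qed

lemma digit_prodI:
  assumes "\<And>i k. a i k \<in> V i k"
  shows "(\<chi> i. digit_val b (a i)) \<in> digit_prod b V"
  using assms unfolding digit_prod_def digit_set_def by auto

text \<open>A product of finite discrete sets is compact by Tychonoff, and \<open>digit_val\<close>
  is continuous on it as a uniform limit of partial sums. Compactness gives the finite subcover in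
  the Hausdorff bound, the closedness for Baire, and measurability of the Cantor set.\<close>

lemma compact_digit_set:
  assumes "2 \<le> b" "\<And>k. V k \<subseteq> {..<b}"
  shows "compact (digit_set b V)"
proof -
  have "compactin (product_topology (\<lambda>_. euclidean) UNIV) (Pi\<^sub>E UNIV V)"
    unfolding compactin_PiE
    using finite_subset[OF assms(2)] by (auto intro!: finite_imp_compact)
  hence comp: "compact (Pi\<^sub>E UNIV V)"
    unfolding euclidean_product_topology by (simp add: compactin_euclidean_iff)
  have cont: "continuous_on (Pi\<^sub>E UNIV V) (digit_val b)"
    unfolding digit_val_def
  proof (rule uniform_limit_theorem)
    show "\<forall>\<^sub>F n in sequentially. continuous_on (Pi\<^sub>E UNIV V)
        (\<lambda>a. \<Sum>k<n. real (a k) / real b ^ Suc k)"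
    proof (intro always_eventually allI continuous_on_sum continuous_on_divide)
      fix n k
      have "continuous_on UNIV (\<lambda>a :: nat \<Rightarrow> nat. a k)"
        by (rule continuous_on_product_coordinates)
      hence "continuous_on (Pi\<^sub>E UNIV V) (\<lambda>a :: nat \<Rightarrow> nat. a k)"
        by (rule continuous_on_subset) auto
      thus "continuous_on (Pi\<^sub>E UNIV V) (\<lambda>a. real (a k))"
        by (rule continuous_on_compose2[rotated, where t = UNIV]) auto
    qed (use assms in auto)
    show "uniform_limit (Pi\<^sub>E UNIV V) (\<lambda>n a. \<Sum>k<n. real (a k) / real b ^ Suc k)
        (\<lambda>a. \<Sum>k. real (a k) / real b ^ Suc k) sequentially"
    proof (rule Weierstrass_m_test)
      show "norm (real (a k) / real b ^ Suc k) \<le> (real b - 1) / real b ^ Suc k"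
        if "a \<in> Pi\<^sub>E UNIV V" for k a
      proof -
        have "a k < b" using that assms(2)[of k] by auto
        thus ?thesis using assms(1) by (auto intro!: divide_right_mono)
      qed
      show "summable (\<lambda>k. (real b - 1) / real b ^ Suc k)"
        using geometric_digit_sums[OF assms(1)] by (rule sums_summable)
    qed
  qed auto
  have "digit_set b V = digit_val b ` (Pi\<^sub>E UNIV V)"
    unfolding digit_set_def by auto
  thus ?thesis using compact_continuous_image[OF cont comp] by simp
qed

lemma compact_digit_prod:
  fixes V :: "'m::finite \<Rightarrow> nat \<Rightarrow> nat set"
  assumes "2 \<le> b" "\<And>i k. V i k \<subseteq> {..<b}"
  shows "compact (digit_prod b V)"
proof -
  have "closed ((\<lambda>x. x $ i) -` digit_set b (V i))" for i
    using compact_imp_closed[OF compact_digit_set[of b "V i"]] assms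
    by (intro continuous_closed_vimage) (auto intro: continuous_intros)
  hence "closed (\<Inter>i. (\<lambda>x. x $ i) -` digit_set b (V i))" by blast
  moreover have "(\<Inter>i. (\<lambda>x. x $ i) -` digit_set b (V i)) = digit_prod b V"
    unfolding digit_prod_def by auto
  moreover have "bounded (digit_prod b V)"
  proof (rule boundedI)
    fix x :: "real ^ 'm" assume "x \<in> digit_prod b V"
    then obtain a where a: "\<And>i k. a i k \<in> V i k" "\<And>i. x $ i = digit_val b (a i)"
      using digit_prodE by blast
    have "norm x \<le> (\<Sum>i\<in>UNIV. \<bar>x $ i\<bar>)" by (rule norm_le_l1_cart)
    also have "\<dots> \<le> (\<Sum>i\<in>(UNIV :: 'm set). 1)"
    proof (rule sum_mono)
      fix i
      have "a i k < b" for k using a assms by blast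
      thus "\<bar>x $ i\<bar> \<le> 1"
        using a(2) digit_val_nonneg[of b "a i"] digit_val_le_1[of b "a i"] assms by simp
    qed
    finally show "norm x \<le> (\<Sum>i\<in>(UNIV :: 'm set). 1)" .
  qed
  ultimately show ?thesis by (simp add: compact_eq_bounded_closed)
qed

section \<open>The Hausdorff dimension of products of Cantor sets\<close>

definition cantor_dim :: "nat \<Rightarrow> ('m::finite \<Rightarrow> nat set) \<Rightarrow> real" where
  "cantor_dim b W = (\<Sum>i\<in>UNIV. ln (real (card (W i)))) / ln (real b)"

lemma powr_cantor_dim:
  assumes "2 \<le> b" "\<And>i. 2 \<le> card (W i)"
  shows "real b powr cantor_dim b W = real (\<Prod>i\<in>UNIV. card (W i))"
proof -
  have pos: "0 < real (card (W i))" for i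
    using assms(2)[of i] by simp
  have "real b powr cantor_dim b W = exp (\<Sum>i\<in>UNIV. ln (real (card (W i))))"
    using assms(1) unfolding cantor_dim_def powr_def by simp
  also have "\<dots> = (\<Prod>i\<in>UNIV. real (card (W i)))"
    using pos by (simp add: exp_sum)
  finally show ?thesis by simp
qed

lemma power_powr_swap:
  fixes x :: real
  assumes "0 < x"
  shows "(x ^ n) powr s = (x powr s) ^ n"
proof -
  have "(x ^ n) powr s = x powr (real n * s)" using assms by (simp add: powr_realpow[symmetric] powr_powr)
  also have "\<dots> = (x powr s) powr real n" by (simp add: powr_powr mult.commute)
  also have "\<dots> = (x powr s) ^ n" using assms by (simp add: powr_realpow)
  finally show ?thesis .
qed

lemma cantor_dim_pos:
  fixes W :: "'m::finite \<Rightarrow> nat set"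
  assumes "2 \<le> b" "\<And>i. 2 \<le> card (W i)"
  shows "0 < cantor_dim b W"
proof -
  have "0 < ln (real (card (W i)))" for i
    using assms(2)[of i] by simp
  hence "0 < (\<Sum>i\<in>UNIV. ln (real (card (W i))))"
    by (intro sum_pos) auto
  thus ?thesis using assms(1) unfolding cantor_dim_def by simp
qed

lemma dist_le_card_mult:
  fixes x y :: "real ^ 'm"
  assumes "\<And>i. \<bar>x $ i - y $ i\<bar> \<le> e"
  shows "dist x y \<le> real CARD('m) * e"
proof -
  have "dist x y = norm (x - y)" by (rule dist_norm)
  also have "\<dots> \<le> (\<Sum>i\<in>UNIV. \<bar>(x - y) $ i\<bar>)" by (rule norm_le_l1_cart)
  also have "\<dots> \<le> (\<Sum>i\<in>(UNIV :: 'm set). e)" using assms by (intro sum_mono) simp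
  finally show ?thesis by simp
qed

text \<open>The \<open>D ^ n\<close> cylinders of level \<open>n\<close> have diameter of order
  \<open>b ^ (-n)\<close>, so their sum is of order \<open>(D / b powr s) ^ n\<close>, which tends
  to 0 because \<open>D = b powr cantor_dim b W\<close>.\<close>

lemma hausdorff_outer_cantor_prod_eq_0:
  fixes W :: "'m::finite \<Rightarrow> nat set"
  assumes b: "2 \<le> b" and W: "\<And>i. W i \<subseteq> {..<b}" and card: "\<And>i. 2 \<le> card (W i)"
    and s: "cantor_dim b W < s"
  shows "hausdorff_outer s (cantor_prod b W) = 0"
proof -
  define D where "D = (\<Prod>i\<in>UNIV. card (W i))"
  define m where "m = real CARD('m)"
  have m: "m \<ge> 1" unfolding m_def by simp
  have s0: "s > 0" using cantor_dim_pos[of b W] b card s by fastforce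
  have Db: "real D = real b powr cantor_dim b W"
    using powr_cantor_dim[of b W] b card unfolding D_def by simp
  have "hausdorff_pre s \<delta> (cantor_prod b W) \<le> ennreal \<epsilon>" if "0 < \<delta>" "0 < \<epsilon>" for \<delta> \<epsilon>
  proof -
    have "(\<lambda>n. m * (1 / real b) ^ n) \<longlonglongrightarrow> m * 0"
      using b by (intro tendsto_intros LIMSEQ_realpow_zero) auto
    hence ev1: "\<forall>\<^sub>F n in sequentially. m * (1 / real b) ^ n < \<delta>"
      using that(1) by (auto dest: order_tendstoD)
    have "(\<lambda>n. m powr s * (real b powr (cantor_dim b W - s)) ^ n) \<longlonglongrightarrow> m powr s * 0"
      using b s by (intro tendsto_intros LIMSEQ_realpow_zero)
        (auto simp: powr_less_one)
    hence ev2: "\<forall>\<^sub>F n in sequentially. m powr s * (real b powr (cantor_dim b W - s)) ^ n < \<epsilon>"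
      using that(2) by (auto dest: order_tendstoD)
    obtain n where n1: "m * (1 / real b) ^ n < \<delta>"
      and n2: "m powr s * (real b powr (cantor_dim b W - s)) ^ n < \<epsilon>"
      using eventually_happens[OF eventually_conj[OF ev1 ev2]] by auto
    have n1': "m / real b ^ n < \<delta>" using n1 by (simp add: power_one_over field_simps)
    have n2': "real D ^ n * (m / real b ^ n) powr s < \<epsilon>"
    proof -
      have "real D ^ n * (m / real b ^ n) powr s = m powr s * (real D * (real b powr - s)) ^ n"
        using b m power_powr_swap[of "real b" n s]
        by (simp add: powr_divide powr_minus_divide power_mult_distrib power_one_over power_divide)
      also have "real D * (real b powr - s) = real b powr (cantor_dim b W - s)"
        unfolding Db by (simp add: powr_add[symmetric])
      finally show ?thesis using n2 by simp
    qed
    define words where "words = Pi\<^sub>E {..<n} (\<lambda>_. Pi\<^sub>E UNIV W)"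
    have finW: "finite (W i)" for i using W finite_subset by blast
    have "finite words" unfolding words_def by (intro finite_PiE) (auto intro: finW)
    moreover have "card words = D ^ n" unfolding words_def D_def by (simp add: card_PiE)
    ultimately obtain h where h: "bij_betw h {0..<D ^ n} words"
      using ex_bij_betw_nat_finite by metis
    define cyl :: "(nat \<Rightarrow> 'm \<Rightarrow> nat) \<Rightarrow> (real ^ 'm) set" where
      "cyl g = {x. \<exists>a. (\<forall>i k. a i k \<in> W i) \<and> (\<forall>i. x $ i = digit_val b (a i)) \<and>
                  (\<forall>k<n. \<forall>i. a i k = g k i)}" for g
    \<comment> \<open>Padding with empty sets is free, since \<open>diam_pow\<close> of the empty
      set is 0.\<close>
    define U where "U j = (if j < D ^ n then cyl (h j) else {})" for j
    have dist: "dist x y \<le> m / real b ^ n" if xy: "x \<in> U j" "y \<in> U j" for x y j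
    proof -
      have "j < D ^ n" using xy unfolding U_def by (auto split: if_splits)
      hence xy': "x \<in> cyl (h j)" "y \<in> cyl (h j)" using xy unfolding U_def by auto
      obtain a where a: "\<forall>i k. a i k \<in> W i" "\<forall>i. x $ i = digit_val b (a i)"
          "\<forall>k<n. \<forall>i. a i k = h j k i"
        using xy'(1) unfolding cyl_def by blast
      obtain a' where a': "\<forall>i k. a' i k \<in> W i" "\<forall>i. y $ i = digit_val b (a' i)"
          "\<forall>k<n. \<forall>i. a' i k = h j k i"
        using xy'(2) unfolding cyl_def by blast
      have "a i k < b" "a' i k < b" for i k using a(1) a'(1) W by blast+
      hence "\<bar>x $ i - y $ i\<bar> \<le> 1 / real b ^ n" for i
        using a(2,3) a'(2,3) by (auto intro!: digit_val_dist_le[OF b])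
      thus ?thesis using dist_le_card_mult[of x y "1 / real b ^ n"] unfolding m_def by simp
    qed
    have pos: "0 \<le> m / real b ^ n" using m by simp
    have bd: "bounded (U j)" for j
    proof (cases "U j = {}")
      case False
      then obtain x where "x \<in> U j" by auto
      thus ?thesis using dist[of x j] unfolding bounded_def by blast
    qed simp
    have diam: "diameter (U j) \<le> m / real b ^ n" for j
      using dist[of _ j] pos by (intro diameter_le) (auto simp: dist_norm)
    have cover: "cantor_prod b W \<subseteq> (\<Union>j. U j)"
    proof
      fix x assume "x \<in> cantor_prod b W"
      then obtain a where a: "\<And>i k. a i k \<in> W i" "\<And>i. x $ i = digit_val b (a i)"
        unfolding cantor_prod_eq_digit_prod using digit_prodE by blast
      define g where "g = restrict (\<lambda>k i. a i k) {..<n}"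
      have "g \<in> words" unfolding words_def g_def using a(1) by auto
      then obtain j where "j < D ^ n" "h j = g"
        using h unfolding bij_betw_def by (metis atLeast0LessThan imageE lessThan_iff)
      hence "x \<in> U j" unfolding U_def cyl_def using a by (auto simp: g_def intro!: exI[of _ a])
      thus "x \<in> (\<Union>j. U j)" by blast
    qed
    have dp: "diam_pow s (U j) \<le> ennreal ((m / real b ^ n) powr s)" for j
      using diam[of j] s0 diameter_ge_0[OF bd, of j] unfolding diam_pow_def
      by (auto intro!: ennreal_leI powr_mono2)
    have "hausdorff_pre s \<delta> (cantor_prod b W) \<le> (\<Sum>j. diam_pow s (U j))"
      unfolding hausdorff_pre_def
      by (rule INF_lower) (use cover bd order_trans[OF diam less_imp_le[OF n1']] in auto)
    also have "\<dots> = (\<Sum>j\<in>{..<D ^ n}. diam_pow s (U j))"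
      by (rule suminf_finite) (auto simp: U_def diam_pow_def)
    also have "\<dots> \<le> (\<Sum>j\<in>{..<D ^ n}. ennreal ((m / real b ^ n) powr s))"
      by (intro sum_mono dp)
    also have "\<dots> = ennreal (real D ^ n * (m / real b ^ n) powr s)"
      by (simp add: ennreal_mult ennreal_of_nat_eq_real_of_nat flip: of_nat_power)
    also have "\<dots> \<le> ennreal \<epsilon>" using n2' by (intro ennreal_leI) simp
    finally show ?thesis .
  qed
  hence "hausdorff_pre s \<delta> (cantor_prod b W) = 0" if "0 < \<delta>" for \<delta>
    using that ennreal_le_epsilon[of 0 "hausdorff_pre s \<delta> (cantor_prod b W)"]
    by (metis add_0 ennreal_le_epsilon le_zero_eq)
  thus ?thesis unfolding hausdorff_outer_def by auto
qed

text \<open>The word \<open>g\<close> fills the positions in \<open>T\<close> and a fixed background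
  \<open>a\<close> the others. The shared background gives different words a common tail, as
  \<open>digit_val_dist_ge\<close> requires.\<close>

definition word_point :: "nat \<Rightarrow> nat set \<Rightarrow> ('m::finite \<Rightarrow> nat \<Rightarrow> nat) \<Rightarrow> (nat \<Rightarrow> 'm \<Rightarrow> nat) \<Rightarrow> real ^ 'm" where
  "word_point b T a g = (\<chi> i. digit_val b (\<lambda>k. if k \<in> T then g k i else a i k))"

text \<open>Points closer than \<open>b ^ (-l)\<close> have prefix integers of length
  \<open>l\<close> differing by at most 1 in each coordinate; they may differ, because close points
  can lie on both sides of a cylinder boundary. That leaves three prefixes per coordinate and
  \<open>n - l\<close> free digit vectors.\<close>

lemma card_words_near_le:
  fixes W :: "'m::finite \<Rightarrow> nat set"
  assumes b: "2 \<le> b" and W: "\<And>i. W i \<subseteq> {..<b}" and a: "\<And>i k. a i k \<in> W i"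
    and U: "\<And>x y. x \<in> U \<Longrightarrow> y \<in> U \<Longrightarrow> dist x y < 1 / real b ^ l" and l: "l \<le> n"
  shows "card {g \<in> Pi\<^sub>E {..<n} (\<lambda>_. Pi\<^sub>E UNIV W). word_point b {..<n} a g \<in> U} \<le>
     3 ^ CARD('m) * (\<Prod>i\<in>UNIV. card (W i)) ^ (n - l)"
proof -
  define A where "A = {g \<in> Pi\<^sub>E {..<n} (\<lambda>_. Pi\<^sub>E UNIV W). word_point b {..<n} a g \<in> U}"
  define dg where "dg g i k = (if k \<in> {..<n} then g k i else a i k)" for g i k
  have finW: "finite (W i)" for i using W finite_subset by blast
  have dgb: "dg g i k < b" if "g \<in> A" for g i k
  proof -
    have "dg g i k \<in> W i" using that a unfolding A_def dg_def by (auto simp: PiE_def Pi_def)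
    thus ?thesis using W by blast
  qed
  show ?thesis
  proof (cases "A = {}")
    case True
    thus ?thesis unfolding A_def by (metis card.empty zero_le)
  next
    case False
    then obtain g0 where g0: "g0 \<in> A" by blast
    define F where "F g i = digit_pre b (dg g i) l" for g i
    \<comment> \<open>Truncated subtraction at \<open>F g0 i = 0\<close> leaves two values instead
      of three, so the factor 3 is an upper bound only.\<close>
    define B where "B = Pi\<^sub>E UNIV (\<lambda>i. {F g0 i - 1..F g0 i + 1})"
    define C where "C = Pi\<^sub>E {l..<n} (\<lambda>_. Pi\<^sub>E UNIV W)"
    have FB: "F g \<in> B" if g: "g \<in> A" for g
    proof -
      have "F g0 i - 1 \<le> F g i \<and> F g i \<le> F g0 i + 1" for i
      proof -
        have "\<bar>word_point b {..<n} a g $ i - word_point b {..<n} a g0 $ i\<bar> \<le>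
            dist (word_point b {..<n} a g) (word_point b {..<n} a g0)"
          by (metis dist_norm component_le_norm_cart vector_minus_component)
        also have "\<dots> < 1 / real b ^ l" using U g g0 unfolding A_def by auto
        finally have "real b ^ l * \<bar>digit_val b (dg g i) - digit_val b (dg g0 i)\<bar> < 1"
          using b unfolding word_point_def dg_def by (simp add: field_simps)
        hence "\<bar>real b ^ l * digit_val b (dg g i) - real b ^ l * digit_val b (dg g0 i)\<bar> < 1"
          by (metis abs_mult abs_of_nonneg of_nat_0_le_iff zero_le_power right_diff_distrib)
        moreover have "real b ^ l * digit_val b (dg h i) =
            real (F h i) + digit_val b (\<lambda>k. dg h i (l + k))"
          "0 \<le> digit_val b (\<lambda>k. dg h i (l + k))" "digit_val b (\<lambda>k. dg h i (l + k)) \<le> 1"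
          if "h \<in> A" for h
          unfolding F_def
          by (rule digit_val_shift[OF b dgb[OF that]] digit_val_nonneg[OF b dgb[OF that]]
              digit_val_le_1[OF b dgb[OF that]])+
        note this[OF g] this[OF g0]
        ultimately have "\<bar>real (F g i) - real (F g0 i)\<bar> < 2"
          by linarith
        thus ?thesis by linarith
      qed
      thus ?thesis unfolding B_def by auto
    qed
    have inj: "inj_on (\<lambda>g. (F g, restrict g {l..<n})) A"
    proof (rule inj_onI)
      fix g g' assume g: "g \<in> A" "g' \<in> A"
        and eq: "(F g, restrict g {l..<n}) = (F g', restrict g' {l..<n})"
      show "g = g'"
      proof (rule PiE_ext)
        show "g \<in> Pi\<^sub>E {..<n} (\<lambda>_. Pi\<^sub>E UNIV W)" "g' \<in> Pi\<^sub>E {..<n} (\<lambda>_. Pi\<^sub>E UNIV W)"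
          using g unfolding A_def by auto
        fix k assume k: "k \<in> {..<n}"
        show "g k = g' k"
        proof (cases "k < l")
          case True
          have "dg g i k = dg g' i k" for i
            using digit_pre_inj[of "dg g i" b "dg g' i" l k] dgb g True eq
            unfolding F_def by (metis prod.inject)
          thus ?thesis using k unfolding dg_def by auto
        next
          case False
          hence "restrict g {l..<n} k = g k" "restrict g' {l..<n} k = g' k" using k by auto
          thus ?thesis using eq by (metis prod.inject)
        qed
      qed
    qed
    have "(\<lambda>g. (F g, restrict g {l..<n})) ` A \<subseteq> B \<times> C"
    proof (rule image_subsetI)
      fix g assume g: "g \<in> A"
      have "restrict g {l..<n} \<in> C" using g unfolding C_def A_def by (auto simp: PiE_def Pi_def)
      thus "(F g, restrict g {l..<n}) \<in> B \<times> C" using FB[OF g] by simp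
    qed
    moreover have "finite B" unfolding B_def by (intro finite_PiE) auto
    moreover have "finite C" unfolding C_def by (intro finite_PiE) (auto intro: finW)
    ultimately have "card A \<le> card (B \<times> C)" using inj by (intro card_inj_on_le) auto
    also have "\<dots> = card B * card C" by (rule card_cartesian_product)
    also have "card C = (\<Prod>i\<in>UNIV. card (W i)) ^ (n - l)"
      unfolding C_def by (simp add: card_PiE)
    also have "card B = (\<Prod>i\<in>UNIV. card {F g0 i - 1..F g0 i + 1})"
      unfolding B_def by (rule card_PiE) simp
    also have "\<dots> \<le> (\<Prod>i\<in>(UNIV :: 'm set). 3)"
      by (intro prod_mono) auto
    finally show ?thesis unfolding A_def by simp
  qed
qed

text \<open>The level is the last one with \<open>b ^ (-l)\<close> above \<open>d\<close>. The next
  level satisfies \<open>D ^ (-l - 1) <= d powr t <= d powr s\<close>, and going back one level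
  costs the factor \<open>D\<close>. If \<open>d = 0\<close> there is no last level, and
  \<open>e\<close> takes over. The strict inequality leaves room to enlarge a piece to an open
  set.\<close>

lemma ex_cylinder_level:
  assumes b: "2 \<le> b" and D: "real D = real b powr t" "1 < D" and s: "0 \<le> s" "s \<le> t"
    and d: "0 \<le> d" "d < 1" and e: "0 < e"
  shows "\<exists>l. d < 1 / real b ^ l \<and> 1 / real D ^ l \<le> real D * (if s = 0 then 1 else d powr s) + e"
proof (cases "d = 0")
  case True
  obtain l where "(1 / real D) ^ l < e"
    using real_arch_pow_inv[of e "1 / real D"] e D(2) by auto
  hence "1 / real D ^ l \<le> real D * (if s = 0 then 1 else d powr s) + e"
    by (auto simp: power_one_over intro: add_increasing)
  thus ?thesis using True b by auto
next
  case False
  define P where "P l \<longleftrightarrow> 1 / real b ^ l \<le> d" for l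
  obtain l0 where "(1 / real b) ^ l0 < d"
    using real_arch_pow_inv[of d "1 / real b"] d False b by auto
  hence "P l0" unfolding P_def by (simp add: power_one_over)
  define L where "L = (LEAST l. P l)"
  have PL: "P L" unfolding L_def using \<open>P l0\<close> by (rule LeastI)
  have "\<not> P 0" using d unfolding P_def by simp
  then obtain l where l: "L = Suc l" using PL by (cases L) auto
  have "\<not> P l" using not_less_Least[of l P] l unfolding L_def by auto
  hence 1: "d < 1 / real b ^ l" unfolding P_def by simp
  have "1 / real D ^ Suc l = (1 / real b ^ Suc l) powr t"
    unfolding D(1) using b power_powr_swap[of "real b" "Suc l" t]
    by (simp add: powr_divide del: power_Suc)
  also have "\<dots> \<le> d powr t"
    using PL l s unfolding P_def by (intro powr_mono2) auto
  also have "\<dots> \<le> d powr s" using s d False by (intro powr_mono') auto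
  also have "\<dots> = (if s = 0 then 1 else d powr s)" using False by simp
  finally have "real D * (1 / real D ^ Suc l) \<le> real D * (if s = 0 then 1 else d powr s)"
    by (rule mult_left_mono) simp
  hence "1 / real D ^ l \<le> real D * (if s = 0 then 1 else d powr s)"
    using D(2) by simp
  thus ?thesis using 1 e by (intro exI[of _ l]) simp
qed

text \<open>A counting form of the mass distribution principle: a cover with small sum is fattened
  to an open one, compactness makes it finite, and at a level finer than all its pieces they capture
  fewer than the \<open>D ^ n\<close> existing words.\<close>

lemma cantor_dim_le_of_hausdorff_outer_eq_0:
  fixes W :: "'m::finite \<Rightarrow> nat set"
  assumes b: "2 \<le> b" and W: "\<And>i. W i \<subseteq> {..<b}" and card: "\<And>i. 2 \<le> card (W i)"
    and s: "0 \<le> s" and H: "hausdorff_outer s (cantor_prod b W) = 0"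
  shows "cantor_dim b W \<le> s"
proof (rule ccontr)
  assume "\<not> cantor_dim b W \<le> s"
  hence st: "s < cantor_dim b W" by simp
  define D where "D = (\<Prod>i\<in>UNIV. card (W i))"
  define K where "K = cantor_prod b W"
  have Db: "real D = real b powr cantor_dim b W"
    using powr_cantor_dim[of b W] b card unfolding D_def by simp
  have "1 < real D"
    unfolding Db using cantor_dim_pos[of b W] b card by (intro gr_one_powr) auto
  hence D1: "1 < D" by simp
  \<comment> \<open>Chosen so that the final count reads
    \<open>1 <= 3 ^ CARD('m) * (D + 1) * c = 1 / 2\<close>.\<close>
  define c where "c = 1 / (2 * 3 ^ CARD('m) * (real D + 1))"
  have c: "c > 0" unfolding c_def using D1 by simp
  \<comment> \<open>Scale \<open>1 / 2\<close> keeps the diameters below 1, as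
    \<open>ex_cylinder_level\<close> demands.\<close>
  have "hausdorff_pre s (1/2) K \<le> hausdorff_outer s K"
    unfolding hausdorff_outer_def by (rule SUP_upper) simp
  hence "hausdorff_pre s (1/2) K < ennreal c" using H c unfolding K_def by simp
  then obtain U where U: "K \<subseteq> (\<Union>i. U i)" "\<And>i. bounded (U i)" "\<And>i. diameter (U i) \<le> 1 / 2"
    and sumU: "(\<Sum>i. diam_pow s (U i)) < ennreal c"
    unfolding hausdorff_pre_def by (auto simp: INF_less_iff)
  define p where "p i = (if U i = {} then 0 else if s = 0 then 1 else diameter (U i) powr s)" for i
  have p: "diam_pow s (U i) = ennreal (p i)" "0 \<le> p i" for i
    unfolding p_def diam_pow_def by auto
  have "\<exists>l. diameter (U i) < 1 / real b ^ l \<and>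
      (U i \<noteq> {} \<longrightarrow> 1 / real D ^ l \<le> real D * p i + c * (1 / 2) ^ Suc i)" for i
    using ex_cylinder_level[OF b Db D1 s less_imp_le[OF st], of "diameter (U i)" "c * (1 / 2) ^ Suc i"]
      c diameter_ge_0[OF U(2), of i] U(3)[of i] unfolding p_def by fastforce
  then obtain l where l: "\<And>i. diameter (U i) < 1 / real b ^ l i"
      "\<And>i. U i \<noteq> {} \<Longrightarrow> 1 / real D ^ l i \<le> real D * p i + c * (1 / 2) ^ Suc i"
    by metis
  \<comment> \<open>One third of the gap: enlarging by \<open>r\<close> at both ends of a chord
    still leaves its length strictly below \<open>b ^ (-l i)\<close>.\<close>
  define r where "r i = (1 / real b ^ l i - diameter (U i)) / 3" for i
  have r: "r i > 0" for i using l(1)[of i] unfolding r_def by simp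
  define V where "V i = (\<Union>x\<in>U i. ball x (r i))" for i
  have V: "dist x y < 1 / real b ^ l i" if xy: "x \<in> V i" "y \<in> V i" for x y i
  proof -
    obtain x' y' where "x' \<in> U i" "y' \<in> U i" "dist x' x < r i" "dist y' y < r i"
      using xy unfolding V_def by auto
    moreover have "dist x' y' \<le> diameter (U i)"
      using calculation U(2) by (intro diameter_bounded_bound) auto
    moreover have "dist x y \<le> dist x' x + dist x' y' + dist y' y"
      using dist_triangle[of x y x'] dist_triangle[of x' y y'] by (simp add: dist_commute)
    ultimately show ?thesis using r[of i] unfolding r_def by argo
  qed
  have "compact K"
    unfolding K_def cantor_prod_eq_digit_prod using b W by (intro compact_digit_prod) auto
  moreover have "K \<subseteq> (\<Union>i. V i)" using U(1) r unfolding V_def by force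
  moreover have "open (V i)" for i unfolding V_def by blast
  ultimately obtain J where J: "finite J" "K \<subseteq> (\<Union>i\<in>J. V i)"
    using compactE_image[of K UNIV V] by metis
  have Vne: "U i \<noteq> {}" if "V i \<noteq> {}" for i using that unfolding V_def by auto
  \<comment> \<open>Empty pieces contribute 0 to the sum and have no bound on
    \<open>D ^ (-l i)\<close>, so they must not be counted.\<close>
  define J' where "J' = {i\<in>J. U i \<noteq> {}}"
  have J': "finite J'" "K \<subseteq> (\<Union>i\<in>J'. V i)"
    using J Vne unfolding J'_def by fastforce+
  define n where "n = Max (insert 0 (l ` J'))"
  have ln: "l i \<le> n" if "i \<in> J'" for i unfolding n_def using that J'(1) by (intro Max_ge) auto
  have "W i \<noteq> {}" for i using card[of i] by auto
  define w where "w i = (SOME d. d \<in> W i)" for i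
  have w: "w i \<in> W i" for i using \<open>W i \<noteq> {}\<close> unfolding w_def by (simp add: some_in_eq)
  define a where "a i k = w i" for i and k :: nat
  define words where "words = Pi\<^sub>E {..<n} (\<lambda>_. Pi\<^sub>E UNIV W)"
  have finW: "finite (W i)" for i using W finite_subset by blast
  have finwords: "finite words" unfolding words_def by (intro finite_PiE) (auto intro: finW)
  have "words \<subseteq> (\<Union>i\<in>J'. {g \<in> words. word_point b {..<n} a g \<in> V i})"
  proof
    fix g assume g: "g \<in> words"
    have "word_point b {..<n} a g \<in> K"
      unfolding K_def cantor_prod_eq_digit_prod word_point_def
      by (intro digit_prodI) (use g w in \<open>auto simp: words_def a_def PiE_def Pi_def\<close>)
    thus "g \<in> (\<Union>i\<in>J'. {g \<in> words. word_point b {..<n} a g \<in> V i})" using J' g by auto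
  qed
  hence "card words \<le> card (\<Union>i\<in>J'. {g \<in> words. word_point b {..<n} a g \<in> V i})"
    using finwords J' by (intro card_mono) auto
  also have "\<dots> \<le> (\<Sum>i\<in>J'. card {g \<in> words. word_point b {..<n} a g \<in> V i})"
    by (rule card_UN_le[OF J'(1)])
  also have "\<dots> \<le> (\<Sum>i\<in>J'. 3 ^ CARD('m) * D ^ (n - l i))"
    unfolding words_def D_def using w ln V
    by (intro sum_mono card_words_near_le[OF b W]) (auto simp: a_def)
  also have "card words = D ^ n" unfolding words_def D_def by (simp add: card_PiE)
  finally have "real (D ^ n) \<le> real (\<Sum>i\<in>J'. 3 ^ CARD('m) * D ^ (n - l i))"
    by (simp only: of_nat_le_iff)
  hence "real D ^ n \<le> real (\<Sum>i\<in>J'. 3 ^ CARD('m) * D ^ (n - l i))"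
    by simp
  also have "\<dots> = 3 ^ CARD('m) * real D ^ n * (\<Sum>i\<in>J'. 1 / real D ^ l i)"
  proof -
    have "real D ^ (n - l i) = real D ^ n / real D ^ l i" if "i \<in> J'" for i
      using D1 ln[OF that] by (intro power_diff) auto
    thus ?thesis by (simp add: sum_distrib_left)
  qed
  finally have "1 \<le> 3 ^ CARD('m) * (\<Sum>i\<in>J'. 1 / real D ^ l i)"
    using D1 by (simp add: field_simps)
  also have "(\<Sum>i\<in>J'. 1 / real D ^ l i) \<le> (\<Sum>i\<in>J'. real D * p i + c * (1 / 2) ^ Suc i)"
    using l(2) by (intro sum_mono) (auto simp: J'_def)
  also have "\<dots> = real D * (\<Sum>i\<in>J'. p i) + c * (\<Sum>i\<in>J'. (1 / 2) ^ Suc i)"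
    by (simp add: sum.distrib sum_distrib_left)
  also have "\<dots> \<le> real D * c + c * 1"
  proof (intro add_mono mult_left_mono)
    have "ennreal (\<Sum>i\<in>J'. p i) = (\<Sum>i\<in>J'. diam_pow s (U i))" using p by (simp add: sum_ennreal)
    also have "\<dots> \<le> (\<Sum>i. diam_pow s (U i))" by (rule sum_le_suminf) (use J' in auto)
    also have "\<dots> < ennreal c" by (rule sumU)
    finally show "(\<Sum>i\<in>J'. p i) \<le> c" using c by (simp add: ennreal_less_iff p(2) sum_nonneg)
    have "(\<Sum>i\<in>J'. (1 / 2) ^ Suc i) \<le> (\<Sum>i. (1 / 2 :: real) ^ Suc i)"
      by (rule sum_le_suminf) (use J' power_half_series sums_summable in auto)
    also have "\<dots> = 1" using power_half_series sums_unique by metis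
    finally show "(\<Sum>i\<in>J'. (1 / 2) ^ Suc i) \<le> (1 :: real)" .
  qed (use c in auto)
  finally have "1 \<le> 3 ^ CARD('m) * ((real D + 1) * c)" by (simp add: algebra_simps)
  also have "\<dots> = 1 / 2" using add_pos_nonneg[of 1 "real D"] unfolding c_def by simp
  finally show False by simp
qed

lemma hausdorff_dim_cantor_prod:
  fixes W :: "'m::finite \<Rightarrow> nat set"
  assumes "2 \<le> b" and "\<And>i. W i \<subseteq> {..<b}" and "\<And>i. 2 \<le> card (W i)"
  shows "hausdorff_dim (cantor_prod b W) = ereal (cantor_dim b W)"
proof (rule antisym)
  show "ereal (cantor_dim b W) \<le> hausdorff_dim (cantor_prod b W)"
    unfolding hausdorff_dim_def
    using cantor_dim_le_of_hausdorff_outer_eq_0[OF assms] by (auto intro!: Inf_greatest)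
  show "hausdorff_dim (cantor_prod b W) \<le> ereal (cantor_dim b W)"
  proof (rule ereal_le_epsilon2)
    fix e :: real assume "0 < e"
    hence "hausdorff_outer (cantor_dim b W + e) (cantor_prod b W) = 0"
      using assms by (intro hausdorff_outer_cantor_prod_eq_0) auto
    moreover have "0 \<le> cantor_dim b W + e"
      using cantor_dim_pos[of b W] assms \<open>0 < e\<close> by fastforce
    ultimately show "hausdorff_dim (cantor_prod b W) \<le> ereal (cantor_dim b W) + ereal e"
      unfolding hausdorff_dim_def by (intro Inf_lower) auto
  qed
qed

section \<open>Singular vectors from constant digit blocks\<close>

lemma is_norm_le_max:
  fixes N :: "real ^ 'm::finite \<Rightarrow> real"
  assumes N: "is_norm N"
  shows "\<exists>C>0. \<forall>v e. (\<forall>i. \<bar>v $ i\<bar> \<le> e) \<longrightarrow> N v \<le> C * e"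
proof -
  have scale: "N (c *\<^sub>R x) = \<bar>c\<bar> * N x" and tri: "N (x + y) \<le> N x + N y"
    and nn: "0 \<le> N x" and zero: "N 0 = 0" for c x y
    using N unfolding is_norm_def by auto
  \<comment> \<open>The added 1 makes \<open>C\<close> positive without looking at the norms of the
    basis vectors.\<close>
  define C where "C = (\<Sum>i\<in>UNIV. N (axis i 1)) + 1"
  have "C > 0" unfolding C_def by (intro add_nonneg_pos sum_nonneg nn) auto
  moreover have "N v \<le> C * e" if v: "\<And>i. \<bar>v $ i\<bar> \<le> e" for v e
  proof -
    have e: "0 \<le> e" using v[of undefined] by linarith
    have "v = (\<Sum>i\<in>UNIV. (v $ i) *\<^sub>R axis i 1)"
      by (simp add: vec_eq_iff axis_def if_distrib cong: if_cong)
    moreover have "N (\<Sum>i\<in>A. f i) \<le> (\<Sum>i\<in>A. N (f i))" if "finite A" for A :: "'m set" and f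
      using that
    proof (induction A rule: finite_induct)
      case (insert x F)
      thus ?case using tri[of "f x" "sum f F"] by simp
    qed (simp add: zero)
    ultimately have "N v \<le> (\<Sum>i\<in>UNIV. N ((v $ i) *\<^sub>R axis i 1))"
      by (metis finite)
    also have "\<dots> \<le> (\<Sum>i\<in>UNIV. e * N (axis i 1))"
      unfolding scale by (intro sum_mono mult_right_mono v nn)
    also have "\<dots> \<le> C * e" unfolding C_def using e by (simp add: sum_distrib_left algebra_simps)
    finally show ?thesis .
  qed
  ultimately show ?thesis by blast
qed

text \<open>A real \<open>Q\<close> is compared with \<open>b ^ L\<close> for \<open>L\<close> the
  floor of \<open>log b Q\<close>, which costs a factor \<open>b powr w\<close>. This factor,
  \<open>B\<close>, the norm constant and \<open>c\<close> are absorbed by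
  \<open>Q powr (w0 - w)\<close>, which tends to 0. The predicate \<open>P\<close> records the shape
  of \<open>q\<close>, so that the argument serves both \<open>sing\<close> and
  \<open>sing_base\<close>.\<close>

lemma singular_criterion:
  fixes N :: "real ^ 'm::finite \<Rightarrow> real"
  assumes N: "is_norm N" and b: "2 \<le> b" and w: "0 \<le> w0" "w0 < w"
    and ev: "\<forall>\<^sub>F L in sequentially. \<exists>(q :: int) (p :: int ^ 'm). P q \<and> 1 \<le> q \<and> of_int q \<le> real b ^ L \<and>
        (\<forall>i. \<bar>of_int q * x $ i - of_int (p $ i)\<bar> \<le> B * real b powr (- w * real L))"
    and c: "0 < c"
  shows "\<forall>\<^sub>F Q in at_top. \<exists>(q :: int) (p :: int ^ 'm). P q \<and> 1 \<le> q \<and> of_int q \<le> Q \<and>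
      N (of_int q *\<^sub>R x - int_vec p) \<le> c * Q powr (- w0)"
proof -
  obtain C where C: "C > 0" "\<And>v e. (\<And>i. \<bar>v $ i\<bar> \<le> e) \<Longrightarrow> N v \<le> C * e"
    using is_norm_le_max[OF N] by blast
  define L where "L Q = nat \<lfloor>log b Q\<rfloor>" for Q
  have b1: "1 < real b" using b by simp
  have "filterlim L sequentially at_top"
    unfolding filterlim_at_top
  proof
    fix n
    show "\<forall>\<^sub>F Q in at_top. n \<le> L Q"
      using eventually_ge_at_top[of "real b ^ n"]
    proof eventually_elim
      case (elim Q)
      moreover have "0 < real b ^ n" using b1 by simp
      ultimately have "log b (real b ^ n) \<le> log b Q" using b1 by (intro log_mono) linarith+
      hence "real n \<le> log b Q" using b1 by (simp add: log_nat_power)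
      thus ?case unfolding L_def by linarith
    qed
  qed
  from eventually_compose_filterlim[OF ev this]
  have 1: "\<forall>\<^sub>F Q in at_top. \<exists>(q :: int) (p :: int ^ 'm). P q \<and> 1 \<le> q \<and> of_int q \<le> real b ^ L Q \<and>
        (\<forall>i. \<bar>of_int q * x $ i - of_int (p $ i)\<bar> \<le> B * real b powr (- w * real (L Q)))" .
  have "((\<lambda>Q. C * \<bar>B\<bar> * real b powr w * Q powr (w0 - w)) \<longlongrightarrow> C * \<bar>B\<bar> * real b powr w * 0) at_top"
    using w by (intro tendsto_intros tendsto_neg_powr filterlim_ident) auto
  hence 2: "\<forall>\<^sub>F Q in at_top. C * \<bar>B\<bar> * real b powr w * Q powr (w0 - w) < c"
    using c by (auto dest: order_tendstoD)
  show ?thesis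
    using 1 2 eventually_ge_at_top[of 1]
  proof eventually_elim
    case (elim Q)
    then obtain q :: int and p :: "int ^ 'm" where q: "P q" "1 \<le> q" "of_int q \<le> real b ^ L Q"
      and p: "\<And>i. \<bar>of_int q * x $ i - of_int (p $ i)\<bar> \<le> B * real b powr (- w * real (L Q))" by blast
    have "0 \<le> log b Q" using elim b1 by simp
    hence L: "real (L Q) \<le> log b Q" "log b Q - 1 \<le> real (L Q)" unfolding L_def by linarith+
    have "real b ^ L Q = real b powr real (L Q)" using b1 by (simp add: powr_realpow)
    also have "\<dots> \<le> real b powr (log b Q)" using L b1 by simp
    also have "\<dots> = Q" using elim b1 by simp
    finally have "of_int q \<le> Q" using q by simp
    have "real b powr (- w * real (L Q)) \<le> real b powr (- w * (log b Q - 1))"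
      using b1 L(2) w by simp
    also have "\<dots> = real b powr w * (real b powr (log b Q)) powr (- w)"
      unfolding powr_powr powr_add[symmetric] by (simp add: algebra_simps)
    also have "real b powr (log b Q) = Q" using elim b1 by simp
    finally have bL: "real b powr (- w * real (L Q)) \<le> real b powr w * Q powr (- w)" .
    have "\<bar>(of_int q *\<^sub>R x - int_vec p) $ i\<bar> \<le> \<bar>B\<bar> * (real b powr w * Q powr (- w))" for i
    proof -
      have "\<bar>(of_int q *\<^sub>R x - int_vec p) $ i\<bar> \<le> B * real b powr (- w * real (L Q))"
        using p[of i] unfolding int_vec_def by simp
      also have "\<dots> \<le> \<bar>B\<bar> * real b powr (- w * real (L Q))" by (intro mult_right_mono) auto
      also have "\<dots> \<le> \<bar>B\<bar> * (real b powr w * Q powr (- w))" using bL by (intro mult_left_mono) auto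
      finally show ?thesis .
    qed
    hence "N (of_int q *\<^sub>R x - int_vec p) \<le> C * (\<bar>B\<bar> * (real b powr w * Q powr (- w)))" by (rule C(2))
    also have "\<dots> = (C * \<bar>B\<bar> * real b powr w * Q powr (w0 - w)) * Q powr (- w0)"
      using powr_add[of Q "w0 - w" "- w0"] by simp
    also have "\<dots> \<le> c * Q powr (- w0)" using elim by (intro mult_right_mono) auto
    finally show ?case using q(1,2) \<open>of_int q \<le> Q\<close> by blast
  qed
qed

text \<open>A digit sequence that is constant on a set \<open>Z\<close> with this property is singular with exponent \<open>w\<close>,
  up to an arbitrarily small loss.\<close>

definition block_cover :: "nat set \<Rightarrow> real \<Rightarrow> bool" where
  "block_cover Z w \<longleftrightarrow> (\<forall>\<^sub>F L in sequentially.
     \<exists>n\<ge>1. n \<le> L \<and> (\<forall>k. n \<le> k \<and> real k < real n + w * real L \<longrightarrow> k \<in> Z))"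

lemma block_cover_mono: "block_cover Z w \<Longrightarrow> Z \<subseteq> Z' \<Longrightarrow> block_cover Z' w"
  unfolding block_cover_def by (erule eventually_mono) blast

lemma block_cover_infinite:
  assumes "block_cover Z w" "0 < w"
  shows "infinite Z"
proof
  assume "finite Z"
  then obtain M where M: "\<forall>k\<in>Z. k < M" unfolding finite_nat_set_iff_bounded by blast
  have "\<forall>\<^sub>F L in sequentially. real M / w < real L"
    using filterlim_real_sequentially unfolding filterlim_at_top_dense by blast
  with assms(1) have "\<forall>\<^sub>F L in sequentially. False"
    unfolding block_cover_def
  proof eventually_elim
    case (elim L)
    then obtain n where n: "\<forall>k. n \<le> k \<and> real k < real n + w * real L \<longrightarrow> k \<in> Z" by blast
    have "real M < w * real L" using elim assms(2) by (simp add: field_simps)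
    hence "n + M \<in> Z" using n by simp
    thus ?case using M by fastforce
  qed
  thus False by simp
qed

lemma digit_val_const_block:
  assumes b: "2 \<le> b" and a: "\<And>k. a k < b" and d: "d < b" and t: "0 \<le> t"
    and blk: "\<And>k. n \<le> k \<Longrightarrow> real k < real n + t \<Longrightarrow> a k = d"
  shows "\<bar>digit_val b (\<lambda>k. a (n + k)) - digit_val b (\<lambda>_. d)\<bar> \<le> real b powr (- t)"
proof -
  define l where "l = nat \<lceil>t\<rceil>"
  have "\<bar>digit_val b (\<lambda>k. a (n + k)) - digit_val b (\<lambda>_. d)\<bar> \<le> 1 / real b ^ l"
  proof (rule digit_val_dist_le[OF b])
    fix k assume "k < l"
    hence "real k < t" unfolding l_def by linarith
    thus "a (n + k) = d" by (intro blk) auto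
  qed (use a d in auto)
  also have "\<dots> = real b powr (- real l)" using b by (simp add: powr_minus_divide powr_realpow)
  also have "\<dots> \<le> real b powr (- t)" using b of_nat_ceiling[of t] unfolding l_def by simp
  finally show ?thesis .
qed

text \<open>If zeros follow position \<open>n\<close>, then \<open>b ^ n\<close> times
  \<open>x\<close> is close to the vector of its prefix integers, so the denominator is a pure power
  of \<open>b\<close>.\<close>

lemma sing_base_of_zero_blocks:
  fixes x :: "real ^ 'm::finite"
  assumes N: "is_norm N" and b: "2 \<le> b" and w: "0 \<le> w0" "w0 < w" and Z: "block_cover Z w"
    and a: "\<And>i k. a i k < b" and x: "\<And>i. x $ i = digit_val b (a i)"
    and zero: "\<And>i k. k \<in> Z \<Longrightarrow> a i k = 0"
  shows "x \<in> sing_base b N w0"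
proof -
  define P where "P q \<longleftrightarrow> (\<exists>n\<ge>1. q = int b ^ n)" for q
  have ev: "\<forall>\<^sub>F L in sequentially. \<exists>(q :: int) (p :: int ^ 'm). P q \<and> 1 \<le> q \<and> of_int q \<le> real b ^ L \<and>
        (\<forall>i. \<bar>of_int q * x $ i - of_int (p $ i)\<bar> \<le> 1 * real b powr (- w * real L))"
    using Z unfolding block_cover_def
  proof eventually_elim
    case (elim L)
    then obtain n where n: "n \<ge> 1" "n \<le> L" "\<And>k. n \<le> k \<Longrightarrow> real k < real n + w * real L \<Longrightarrow> k \<in> Z"
      by blast
    have "\<bar>of_int (int b ^ n) * x $ i - of_int ((\<chi> i. int (digit_pre b (a i) n)) $ i)\<bar> \<le>
        1 * real b powr (- w * real L)" for i
      using digit_val_const_block[of b "a i" 0 "w * real L" n] digit_val_shift[of b "a i" n]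
        b a zero n(3) w unfolding x digit_val_zero by simp
    moreover have "P (int b ^ n)" unfolding P_def using n by blast
    moreover have "1 \<le> int b ^ n" "of_int (int b ^ n) \<le> real b ^ L"
      using b n by (auto intro: power_increasing)
    ultimately show ?case by blast
  qed
  have "\<forall>\<^sub>F Q in at_top. \<exists>n (p :: int ^ 'm). 1 \<le> n \<and> real b ^ n \<le> Q \<and>
      N (real b ^ n *\<^sub>R x - int_vec p) \<le> c * Q powr (- w0)" if "c > 0" for c
    using singular_criterion[OF N b w ev that]
    by (rule eventually_mono) (unfold P_def, metis of_int_of_nat_eq of_nat_power)
  thus ?thesis unfolding sing_base_def by auto
qed

text \<open>The constant expansion of digit \<open>d\<close> has value \<open>d / (b - 1)\<close>,
  so in front of a block \<open>b ^ n * x $ i\<close> is close to an integer plus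
  \<open>d i / (b - 1)\<close>. The factor \<open>b - 1\<close> clears this denominator in all
  coordinates at once.\<close>

lemma sing_of_const_blocks:
  fixes x :: "real ^ 'm::finite"
  assumes N: "is_norm N" and b: "2 \<le> b" and w: "0 \<le> w0" "w0 < w" and Z: "block_cover Z w"
    and a: "\<And>i k. a i k < b" and x: "\<And>i. x $ i = digit_val b (a i)"
    and const: "\<And>i k. k \<in> Z \<Longrightarrow> a i k = d i"
  shows "x \<in> sing N w0"
proof -
  have "infinite Z" using block_cover_infinite[OF Z] w by simp
  then obtain k0 where "k0 \<in> Z" by (metis ex_in_conv finite.emptyI)
  hence d: "d i < b" for i using const a by metis
  \<comment> \<open>\<open>(b - 1) * b ^ n\<close> is bounded by \<open>b ^ (n + 1)\<close> only, so
    the block for \<open>L - 1\<close> serves \<open>L\<close>. The shorter block shows up as the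
    factor \<open>b powr w\<close> below.\<close>
  have "\<forall>\<^sub>F L in sequentially. \<exists>n\<ge>1. n \<le> L - 1 \<and>
      (\<forall>k. n \<le> k \<and> real k < real n + w * real (L - 1) \<longrightarrow> k \<in> Z)"
    using eventually_compose_filterlim[OF Z[unfolded block_cover_def] filterlim_minus_const_nat_at_top] .
  hence ev: "\<forall>\<^sub>F L in sequentially. \<exists>(q :: int) (p :: int ^ 'm). True \<and> 1 \<le> q \<and> of_int q \<le> real b ^ L \<and>
        (\<forall>i. \<bar>of_int q * x $ i - of_int (p $ i)\<bar> \<le> ((real b - 1) * real b powr w) * real b powr (- w * real L))"
    using eventually_ge_at_top[of 1]
  proof eventually_elim
    case (elim L)
    define t where "t = w * real (L - 1)"
    have t: "0 \<le> t" "- t = w + - w * real L"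
      using w elim(2) unfolding t_def by (auto simp: of_nat_diff algebra_simps)
    obtain n where n: "n \<ge> 1" "n \<le> L - 1" "\<And>k. n \<le> k \<Longrightarrow> real k < real n + t \<Longrightarrow> k \<in> Z"
      using elim(1) unfolding t_def by blast
    define q where "q = int (b - 1) * int b ^ n"
    define p :: "int ^ 'm" where "p = (\<chi> i. int (b - 1) * int (digit_pre b (a i) n) + int (d i))"
    have b1: "of_int (int (b - 1)) = real b - 1" using b by (simp add: of_nat_diff)
    have "\<bar>of_int q * x $ i - of_int (p $ i)\<bar> \<le>
        ((real b - 1) * real b powr w) * real b powr (- w * real L)" for i
    proof -
      have "of_int q * x $ i - of_int (p $ i) =
          (real b - 1) * (real b ^ n * digit_val b (a i)) - (real b - 1) * real (digit_pre b (a i) n) - real (d i)"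
        unfolding q_def p_def x using b1 by simp
      also have "\<dots> = (real b - 1) * (digit_val b (\<lambda>k. a i (n + k)) - digit_val b (\<lambda>_. d i))"
        using b digit_val_shift[of b "a i" n, OF b a] unfolding digit_val_const[OF b]
        by (simp add: right_diff_distrib distrib_left)
      finally have "\<bar>of_int q * x $ i - of_int (p $ i)\<bar> =
          (real b - 1) * \<bar>digit_val b (\<lambda>k. a i (n + k)) - digit_val b (\<lambda>_. d i)\<bar>"
        using b by (simp add: abs_mult)
      also have "\<dots> \<le> (real b - 1) * real b powr (- t)"
        using b a d t(1) by (intro mult_left_mono digit_val_const_block const n(3)) auto
      also note t(2)
      finally show ?thesis by (simp only: powr_add mult.assoc)
    qed
    moreover have "1 \<le> q"
    proof -
      have "1 \<le> int (b - 1)" "1 \<le> int b ^ n" using b by auto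
      thus ?thesis unfolding q_def using mult_mono[of 1 "int (b - 1)" 1 "int b ^ n"] by simp
    qed
    moreover have "of_int q \<le> real b ^ L"
    proof -
      have "of_int q \<le> real b * real b ^ n" unfolding q_def using b by (simp add: of_nat_diff)
      also have "\<dots> = real b ^ Suc n" by simp
      also have "\<dots> \<le> real b ^ L" using n elim b by (intro power_increasing) auto
      finally show ?thesis .
    qed
    ultimately show ?case by blast
  qed
  show ?thesis
    unfolding sing_def using singular_criterion[OF N b w ev] by simp
qed

lemma sing_base_subset_sing:
  assumes "2 \<le> b"
  shows "sing_base b N w \<subseteq> sing N w"
proof
  fix x assume x: "x \<in> sing_base b N w"
  have "\<forall>\<^sub>F Q in at_top. \<exists>(q :: int) p. 1 \<le> q \<and> of_int q \<le> Q \<and>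
      N (of_int q *\<^sub>R x - int_vec p) \<le> c * Q powr (- w)" if "c > 0" for c
  proof -
    have "\<forall>\<^sub>F Q in at_top. \<exists>n p. 1 \<le> n \<and> real b ^ n \<le> Q \<and>
        N (real b ^ n *\<^sub>R x - int_vec p) \<le> c * Q powr (- w)"
      using x that unfolding sing_base_def by auto
    thus ?thesis
    proof (rule eventually_mono)
      fix Q assume "\<exists>n p. 1 \<le> n \<and> real b ^ n \<le> Q \<and>
        N (real b ^ n *\<^sub>R x - int_vec p) \<le> c * Q powr (- w)"
      then obtain n p where "real b ^ n \<le> Q" "N (real b ^ n *\<^sub>R x - int_vec p) \<le> c * Q powr (- w)"
        by blast
      moreover have "1 \<le> int b ^ n" using assms by simp
      ultimately show "\<exists>(q :: int) p. 1 \<le> q \<and> of_int q \<le> Q \<and>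
          N (of_int q *\<^sub>R x - int_vec p) \<le> c * Q powr (- w)"
        by (intro exI[of _ "int b ^ n"] exI[of _ p]) simp
    qed
  qed
  thus "x \<in> sing N w" unfolding sing_def by auto
qed

section \<open>Sets of positions with long blocks\<close>

lemma block_cover_geometric:
  assumes A: "0 < A" and \<Lambda>: "1 < \<Lambda>" and B: "w * (A * \<Lambda>) \<le> B - A" and w: "0 \<le> w'" "w' < w"
  shows "block_cover (\<Union>j. {nat \<lceil>A * \<Lambda> ^ j\<rceil>..<nat \<lceil>B * \<Lambda> ^ j\<rceil>}) w'"
proof -
  have ex: "\<exists>j. real L < A * \<Lambda> ^ j" for L
    using real_arch_pow[OF \<Lambda>, of "real L / A"] A by (auto simp: field_simps)
  \<comment> \<open>The first bound lets \<open>(w - w') * L\<close> pay for rounding the block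
    start up; the second puts \<open>L\<close> beyond the start of block 0.\<close>
  have "\<forall>\<^sub>F L in sequentially. 1 / (w - w') \<le> real L" "\<forall>\<^sub>F L in sequentially. A \<le> real L"
    using filterlim_real_sequentially unfolding filterlim_at_top by blast+
  thus ?thesis
    unfolding block_cover_def
  proof eventually_elim
    case (elim L)
    \<comment> \<open>\<open>L\<close> lies between the starts of blocks \<open>J - 1\<close> and
      \<open>J\<close>. The worst case is \<open>L\<close> close to the start of \<open>J\<close>,
      and the hypothesis on \<open>B - A\<close> says that block \<open>J - 1\<close> is long enough
      even there.\<close>
    define J where "J = (LEAST j. real L < A * \<Lambda> ^ j)"
    have J: "real L < A * \<Lambda> ^ J" unfolding J_def by (rule LeastI_ex[OF ex])
    have "J \<noteq> 0" using J elim by (intro notI) simp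
    then obtain j where j: "J = Suc j" by (cases J) auto
    have "\<not> real L < A * \<Lambda> ^ j" using not_less_Least[of j "\<lambda>j. real L < A * \<Lambda> ^ j"] j
      unfolding J_def by simp
    hence nL: "nat \<lceil>A * \<Lambda> ^ j\<rceil> \<le> L" by linarith
    have pos: "0 < A * \<Lambda> ^ j" using A \<Lambda> by simp
    have "k \<in> {nat \<lceil>A * \<Lambda> ^ j\<rceil>..<nat \<lceil>B * \<Lambda> ^ j\<rceil>}"
      if k: "nat \<lceil>A * \<Lambda> ^ j\<rceil> \<le> k" "real k < real (nat \<lceil>A * \<Lambda> ^ j\<rceil>) + w' * real L" for k
    proof -
      have "1 \<le> (w - w') * real L" using elim w by (simp add: field_simps)
      moreover have "w * real L \<le> w * (A * \<Lambda> ^ Suc j)" using J j w by (intro mult_left_mono) auto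
      moreover have "w * (A * \<Lambda> ^ Suc j) \<le> (B - A) * \<Lambda> ^ j"
        using mult_right_mono[OF B, of "\<Lambda> ^ j"] \<Lambda> by (simp add: algebra_simps)
      moreover have "real k < A * \<Lambda> ^ j + 1 + w' * real L" using k(2) pos by linarith
      ultimately have "real k < B * \<Lambda> ^ j" by (simp add: algebra_simps)
      hence "k < nat \<lceil>B * \<Lambda> ^ j\<rceil>" by linarith
      thus ?thesis using k by simp
    qed
    moreover have "1 \<le> nat \<lceil>A * \<Lambda> ^ j\<rceil>" using pos by linarith
    ultimately show ?case using nL by blast
  qed
qed

text \<open>With block ratios \<open>\<beta>\<close> and \<open>\<gamma>\<close> alternating, the two exponents are \<open>(\<beta> - 1) / (\<beta> \<gamma>)\<close> and
  \<open>(\<gamma> - 1) / (\<beta> \<gamma>)\<close>; fixing the first to be \<open>w\<close>, the second is maximal for \<open>\<beta> = 1 / (1 - sqrt w)\<close>,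
  \<open>\<gamma> = 1 / sqrt w\<close>.\<close>

lemma ex_complementary_block_covers:
  assumes w: "0 < w" "w < 1" and w0: "0 \<le> w0" "w0 < w" and w1: "0 \<le> w1" "w1 < (1 - sqrt w)\<^sup>2"
  shows "\<exists>Z. block_cover Z w0 \<and> block_cover (- Z) w1"
proof -
  define s where "s = sqrt w"
  have s: "0 < s" "s < 1" "w = s\<^sup>2" using w unfolding s_def by auto
  define \<beta> where "\<beta> = 1 / (1 - s)"
  define \<Lambda> where "\<Lambda> = \<beta> / s"
  have \<beta>: "1 < \<beta>" unfolding \<beta>_def using s by simp
  have \<beta>\<Lambda>: "\<beta> < \<Lambda>" unfolding \<Lambda>_def using s \<beta> by (simp add: field_simps)
  define Z where "Z = (\<Union>j. {nat \<lceil>1 * \<Lambda> ^ j\<rceil>..<nat \<lceil>\<beta> * \<Lambda> ^ j\<rceil>})"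
  define Z' where "Z' = (\<Union>j. {nat \<lceil>\<beta> * \<Lambda> ^ j\<rceil>..<nat \<lceil>\<Lambda> * \<Lambda> ^ j\<rceil>})"
  have "block_cover Z w0"
    unfolding Z_def
  proof (rule block_cover_geometric)
    show "w * (1 * \<Lambda>) \<le> \<beta> - 1"
      using s unfolding \<Lambda>_def \<beta>_def by (simp add: field_simps power2_eq_square)
  qed (use w0 \<beta> \<beta>\<Lambda> in auto)
  moreover have "block_cover Z' w1"
    unfolding Z'_def
  proof (rule block_cover_geometric)
    have "\<beta> * \<Lambda> = 1 / ((1 - s)\<^sup>2 * s)" unfolding \<Lambda>_def \<beta>_def by (simp add: power2_eq_square)
    hence "(1 - s)\<^sup>2 * (\<beta> * \<Lambda>) = 1 / s" using s by simp
    also have "1 / s = \<beta> * (1 - s) / s" using s unfolding \<beta>_def by simp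
    also have "\<dots> = \<Lambda> - \<beta>" using s unfolding \<Lambda>_def by (simp add: field_simps)
    finally show "(1 - s)\<^sup>2 * (\<beta> * \<Lambda>) \<le> \<Lambda> - \<beta>" by simp
  qed (use w1 \<beta> \<beta>\<Lambda> in \<open>auto simp: s_def\<close>)
  \<comment> \<open>The families interlace: block \<open>i\<close> of \<open>Z\<close> spans
    \<open>\<Lambda> ^ i\<close> to \<open>\<beta> * \<Lambda> ^ i\<close>, and block
    \<open>i\<close> of \<open>Z'\<close> continues from there to
    \<open>\<Lambda> ^ (i + 1)\<close>. Both round with the same ceilings.\<close>
  moreover have "Z' \<subseteq> - Z"
  proof -
    have False if k: "nat \<lceil>1 * \<Lambda> ^ i\<rceil> \<le> k" "k < nat \<lceil>\<beta> * \<Lambda> ^ i\<rceil>"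
        "nat \<lceil>\<beta> * \<Lambda> ^ j\<rceil> \<le> k" "k < nat \<lceil>\<Lambda> * \<Lambda> ^ j\<rceil>" for i j k
    proof (cases "i \<le> j")
      case True
      hence "\<beta> * \<Lambda> ^ i \<le> \<beta> * \<Lambda> ^ j"
        using \<beta> \<beta>\<Lambda> by (intro mult_left_mono power_increasing) auto
      thus False using k by linarith
    next
      case False
      hence "\<Lambda> ^ Suc j \<le> \<Lambda> ^ i"
        using \<beta> \<beta>\<Lambda> by (intro power_increasing) auto
      hence "\<Lambda> * \<Lambda> ^ j \<le> 1 * \<Lambda> ^ i" by simp
      thus False using k by linarith
    qed
    thus ?thesis unfolding Z_def Z'_def by fastforce
  qed
  ultimately show ?thesis using block_cover_mono by blast
qed

text \<open>The block from \<open>(j + 1)!\<close> must serve every \<open>L\<close> below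
  \<open>(j + 2)!\<close>, hence its length. Seen from \<open>n = (j + 1)!\<close>, all earlier
  blocks end by \<open>j! + w * n\<close>, and \<open>j!\<close> is negligible against
  \<open>n\<close>.\<close>

lemma ex_sparse_block_cover:
  assumes w: "0 < w" "w < 1"
  shows "\<exists>Z. block_cover Z w \<and>
    (\<forall>\<theta><1 - w. \<exists>\<^sub>F n in sequentially. \<theta> * real n \<le> real (card ({..<n} - Z)))"
proof -
  define Z where "Z = (\<Union>j. {k. fact (Suc j) \<le> k \<and> real k < fact (Suc j) + w * fact (Suc (Suc j))})"
  have "block_cover Z w"
    unfolding block_cover_def
    using eventually_ge_at_top[of 1]
  proof eventually_elim
    case (elim L)
    define J where "J = (LEAST j. L < fact j)"
    have J: "L < fact J" unfolding J_def
      by (rule LeastI[of _ "Suc L"]) (use fact_ge_self[of "Suc L"] in linarith)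
    \<comment> \<open>\<open>0! = 1! = 1\<close>, so \<open>1 <= L < J!\<close> excludes the indices
      0 and 1 and \<open>(J - 1)!\<close> is the start of a block of \<open>Z\<close>.\<close>
    have "1 < J"
    proof (rule ccontr)
      assume "\<not> 1 < J"
      hence "J = 0 \<or> J = 1" by linarith
      thus False using J elim by auto
    qed
    then obtain j where j: "J = Suc (Suc j)" by (metis One_nat_def not0_implies_Suc not_less_zero less_irrefl)
    have "\<not> L < fact (Suc j)" using not_less_Least[of "Suc j" "\<lambda>j. L < fact j"] j
      unfolding J_def by simp
    moreover have "k \<in> Z" if "fact (Suc j) \<le> k" "real k < real (fact (Suc j)) + w * real L" for k
    proof -
      have "real L \<le> real (fact J)" using J by (simp only: of_nat_le_iff less_imp_le)
      hence "w * real L \<le> w * real (fact J)" using w by (intro mult_left_mono) auto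
      hence "real k < fact (Suc j) + w * fact (Suc (Suc j))"
        using that j by (simp del: fact_Suc)
      thus ?thesis unfolding Z_def using that by blast
    qed
    ultimately show ?case
      using fact_ge_1[of "Suc j", where ?'a = nat] by (intro exI[of _ "fact (Suc j)"]) (simp del: fact_Suc)
  qed
  moreover have "\<exists>\<^sub>F n in sequentially. \<theta> * real n \<le> real (card ({..<n} - Z))" if \<theta>: "\<theta> < 1 - w" for \<theta>
    unfolding frequently_sequentially
  proof
    fix n0
    \<comment> \<open>Besides \<open>w * n\<close> at most \<open>j! + 1 <= 2 * j!\<close> positions
      are lost, and this \<open>j\<close> gives
      \<open>2 * j! <= (1 - w - \<theta>) * (j + 1)!\<close>.\<close>
    obtain j where j: "n0 \<le> j" "2 / (1 - w - \<theta>) \<le> real j"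
      by (metis nat_le_linear of_nat_mono order_trans real_arch_simple)
    define n :: nat where "n = fact (Suc j)"
    have "n0 \<le> n" using j(1) fact_ge_self[of "Suc j"] unfolding n_def by linarith
    moreover have "\<theta> * real n \<le> real (card ({..<n} - Z))"
    proof -
      define k0 where "k0 = nat \<lceil>fact j + w * real n\<rceil>"
      have "{k0..<n} \<subseteq> {..<n} - Z"
      proof
        fix k assume k: "k \<in> {k0..<n}"
        have "\<not> real k < fact (Suc i) + w * fact (Suc (Suc i))" if "fact (Suc i) \<le> k" for i
        proof -
          have "Suc i < Suc j"
          proof (rule ccontr)
            assume "\<not> Suc i < Suc j"
            hence "n \<le> fact (Suc i)" unfolding n_def by (intro fact_mono) simp
            thus False using k that by simp
          qed
          hence "(fact (Suc i) :: real) \<le> fact j" "(fact (Suc (Suc i)) :: real) \<le> fact (Suc j)"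
            by (intro fact_mono; simp)+
          hence "fact (Suc i) + w * fact (Suc (Suc i)) \<le> fact j + w * real n"
            unfolding n_def of_nat_fact using w by (intro add_mono mult_left_mono) auto
          also have "\<dots> \<le> real k" using k unfolding k0_def by simp
          finally show ?thesis by simp
        qed
        thus "k \<in> {..<n} - Z" using k unfolding Z_def by auto
      qed
      hence "card {k0..<n} \<le> card ({..<n} - Z)" by (intro card_mono) auto
      moreover have "real n - (fact j + w * real n + 1) \<le> real (card {k0..<n})"
      proof -
        have "0 \<le> fact j + w * real n" using w by simp
        hence "real k0 \<le> fact j + w * real n + 1" unfolding k0_def by linarith
        thus ?thesis by simp
      qed
      moreover have "fact j + 1 \<le> (1 - w - \<theta>) * real n"
      proof -
        have "fact j + 1 \<le> 2 * (fact j :: real)" using fact_ge_1[of j, where ?'a = real] by linarith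
        also have "2 \<le> (1 - w - \<theta>) * real (Suc j)"
          using j(2) \<theta> by (simp add: field_simps)
        hence "2 * fact j \<le> (1 - w - \<theta>) * real (Suc j) * (fact j :: real)"
          by (intro mult_right_mono) auto
        also have "\<dots> = (1 - w - \<theta>) * real n" unfolding n_def by (simp add: algebra_simps)
        finally show ?thesis .
      qed
      ultimately show ?thesis by (simp add: algebra_simps)
    qed
    ultimately show "\<exists>n\<ge>n0. \<theta> * real n \<le> real (card ({..<n} - Z))" by blast
  qed
  ultimately show ?thesis by blast
qed

section \<open>Packing dimension of totally irrational points\<close>

lemma packing_measure_mono: "A \<subseteq> B \<Longrightarrow> packing_measure s A \<le> packing_measure s B"
  unfolding packing_measure_def by (rule INF_superset_mono) auto

lemma packing_dim_mono:
  assumes "A \<subseteq> B"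
  shows "packing_dim A \<le> packing_dim B"
  unfolding packing_dim_def
proof (rule Inf_superset_mono)
  have "packing_measure s A = 0" if "packing_measure s B = 0" for s
    using packing_measure_mono[OF assms, of s] that by simp
  thus "{ereal s |s. 0 \<le> s \<and> packing_measure s B = 0} \<subseteq>
      {ereal s |s. 0 \<le> s \<and> packing_measure s A = 0}" by auto
qed

lemma packing_dim_nonneg: "0 \<le> packing_dim A"
  unfolding packing_dim_def by (rule Inf_greatest) auto

lemma packing_pre_ge_of_separated:
  fixes c :: "'i \<Rightarrow> 'a::metric_space"
  assumes "finite I" "0 < r" "r \<le> \<delta>" "\<And>i. i \<in> I \<Longrightarrow> c i \<in> A"
    and sep: "\<And>i j. i \<in> I \<Longrightarrow> j \<in> I \<Longrightarrow> i \<noteq> j \<Longrightarrow> 2 * r < dist (c i) (c j)"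
  shows "ennreal (real (card I) * (2 * r) powr s) \<le>
    (SUP P \<in> {P. delta_packing \<delta> A P}. infsum (\<lambda>(x, r). ennreal ((2 * r) powr s)) P)"
proof -
  define P where "P = (\<lambda>i. (c i, r)) ` I"
  have inj: "inj_on (\<lambda>i. (c i, r)) I"
    using sep \<open>0 < r\<close> by (intro inj_onI) force
  have "cball (c i) r \<inter> cball (c j) r = {}" if "i \<in> I" "j \<in> I" "i \<noteq> j" for i j
  proof -
    have False if "dist (c i) y \<le> r" "dist (c j) y \<le> r" for y
      using that sep[OF \<open>i \<in> I\<close> \<open>j \<in> I\<close> \<open>i \<noteq> j\<close>] dist_triangle2[of "c i" "c j" y] by linarith
    thus ?thesis by auto
  qed
  hence "disjoint_family_on (\<lambda>(x, r). cball x r) P"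
    unfolding P_def disjoint_family_on_def by auto
  hence "delta_packing \<delta> A P"
    unfolding delta_packing_def P_def using assms by (auto intro: countable_finite)
  hence "infsum (\<lambda>(x, r). ennreal ((2 * r) powr s)) P \<le>
      (SUP P \<in> {P. delta_packing \<delta> A P}. infsum (\<lambda>(x, r). ennreal ((2 * r) powr s)) P)"
    by (intro SUP_upper) simp
  moreover have "infsum (\<lambda>(x, r). ennreal ((2 * r) powr s)) P = (\<Sum>i\<in>I. ennreal ((2 * r) powr s))"
    using \<open>finite I\<close> inj unfolding P_def by (simp add: sum.reindex)
  moreover have "\<dots> = ennreal (real (card I) * (2 * r) powr s)"
    by (simp add: ennreal_mult ennreal_of_nat_eq_real_of_nat)
  ultimately show ?thesis by simp
qed

lemma dist_word_point_ge:
  fixes W :: "'m::finite \<Rightarrow> nat set"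
  assumes b: "2 \<le> b" and W: "\<And>i. W i \<subseteq> {..<b}" and a: "\<And>i k. a i k < b"
    and T: "T \<subseteq> {..<n}"
    and g: "g \<in> Pi\<^sub>E T (\<lambda>_. Pi\<^sub>E UNIV W)" "g' \<in> Pi\<^sub>E T (\<lambda>_. Pi\<^sub>E UNIV W)" "g \<noteq> g'"
  shows "1 / real b ^ n \<le> dist (word_point b T a g) (word_point b T a g')"
proof -
  obtain k where k: "k \<in> T" "g k \<noteq> g' k" using PiE_ext[OF g(1,2)] g(3) by blast
  then obtain i where i: "g k i \<noteq> g' k i" by blast
  define dg where "dg h k = (if k \<in> T then h k i else a i k)" for h k
  have "dg h k < b" if "h \<in> Pi\<^sub>E T (\<lambda>_. Pi\<^sub>E UNIV W)" for h k
  proof (cases "k \<in> T")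
    case True
    hence "h k i \<in> W i" using that by (auto simp: PiE_def Pi_def)
    thus ?thesis using True W unfolding dg_def by auto
  qed (use a in \<open>auto simp: dg_def\<close>)
  moreover have "dg g k \<noteq> dg g' k" using i k unfolding dg_def by simp
  moreover have "dg g k = dg g' k" if "k \<ge> n" for k
    using that T unfolding dg_def by auto
  ultimately have "1 / real b ^ n \<le> \<bar>digit_val b (dg g) - digit_val b (dg g')\<bar>"
    using b g by (intro digit_val_dist_ge) auto
  also have "\<dots> = \<bar>(word_point b T a g - word_point b T a g') $ i\<bar>"
    unfolding word_point_def dg_def by simp
  also have "\<dots> \<le> dist (word_point b T a g) (word_point b T a g')"
    unfolding dist_norm by (rule component_le_norm_cart)
  finally show ?thesis .
qed

text \<open>Words on the free positions in \<open>{k0..<n}\<close> give at least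
  \<open>b powr (t * (\<theta> * n - k0))\<close> points separated by \<open>b ^ (-n)\<close>.
  Density moves them into \<open>F\<close> without destroying the separation, so the packing sums
  grow like \<open>b powr ((t * \<theta> - s) * n)\<close> along the good \<open>n\<close>.\<close>

lemma packing_pre_eq_top:
  fixes W :: "'m::finite \<Rightarrow> nat set" and F :: "(real ^ 'm) set"
  assumes b: "2 \<le> b" and W: "\<And>i. W i \<subseteq> {..<b}" and card: "\<And>i. 2 \<le> card (W i)"
    and a: "\<And>i k. a i k < b"
    and freq: "\<exists>\<^sub>F n in sequentially. \<theta> * real n \<le> real (card ({..<n} \<inter> S))"
    and s: "0 \<le> s" "s < \<theta> * cantor_dim b W"
    and dense: "\<And>n g. g \<in> Pi\<^sub>E (S \<inter> {k0..<n}) (\<lambda>_. Pi\<^sub>E UNIV W) \<Longrightarrow>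
        word_point b (S \<inter> {k0..<n}) a g \<in> closure F"
  shows "packing_pre s F = \<infinity>"
proof -
  define D where "D = (\<Prod>i\<in>UNIV. card (W i))"
  define t where "t = cantor_dim b W"
  have t: "t > 0" unfolding t_def using b card by (rule cantor_dim_pos)
  have Db: "real D = real b powr t"
    using powr_cantor_dim[of b W] b card unfolding D_def t_def by simp
  have finW: "finite (W i)" for i using W finite_subset by blast
  \<comment> \<open>Collects the loss from the \<open>k0\<close> fixed digits and from the diameter
    \<open>2 / 3 * b ^ (-n)\<close> of the balls.\<close>
  define \<kappa> where "\<kappa> = real b powr (- t * real k0) * (2 / 3) powr s"
  have \<kappa>: "\<kappa> > 0" unfolding \<kappa>_def using b by simp
  have large: "ennreal B \<le>
      (SUP P \<in> {P. delta_packing \<delta> F P}. infsum (\<lambda>(x, r). ennreal ((2 * r) powr s)) P)"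
    if "0 < \<delta>" "0 < B" for \<delta> B
  proof -
    have "1 < real b powr (t * \<theta> - s)"
      using b s by (intro gr_one_powr) (auto simp: t_def mult.commute)
    then obtain n1 where "B / \<kappa> < (real b powr (t * \<theta> - s)) ^ n1"
      using real_arch_pow by blast
    hence "B < \<kappa> * (real b powr (t * \<theta> - s)) ^ n1" using \<kappa> by (simp add: field_simps)
    moreover have "(real b powr (t * \<theta> - s)) ^ n1 \<le> (real b powr (t * \<theta> - s)) ^ n" if "n1 \<le> n" for n
      using that \<open>1 < real b powr (t * \<theta> - s)\<close> by (intro power_increasing) auto
    ultimately have ev1: "\<forall>\<^sub>F n in sequentially. B < \<kappa> * (real b powr (t * \<theta> - s)) ^ n"
      using \<kappa> unfolding eventually_sequentially by (meson less_le_trans mult_le_cancel_left_pos)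
    have "(\<lambda>n. (1 / real b) ^ n) \<longlonglongrightarrow> 0" using b by (intro LIMSEQ_realpow_zero) auto
    hence ev2: "\<forall>\<^sub>F n in sequentially. (1 / real b) ^ n < \<delta>"
      using \<open>0 < \<delta>\<close> by (auto dest: order_tendstoD)
    obtain n where n: "\<theta> * real n \<le> real (card ({..<n} \<inter> S))"
        "B < \<kappa> * (real b powr (t * \<theta> - s)) ^ n" "(1 / real b) ^ n < \<delta>"
      using frequently_ex[OF frequently_eventually_frequently[OF freq eventually_conj[OF ev1 ev2]]]
      by blast
    define T where "T = S \<inter> {k0..<n}"
    define Wd where "Wd = Pi\<^sub>E T (\<lambda>_. Pi\<^sub>E UNIV W)"
    define r where "r = 1 / (3 * real b ^ n)"
    have bn: "real b ^ n > 0" using b by simp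
    have finT: "finite T" unfolding T_def by simp
    have finWd: "finite Wd" unfolding Wd_def using finT by (intro finite_PiE) (auto intro: finW)
    have cardT: "\<theta> * real n - real k0 \<le> real (card T)"
    proof -
      have "{..<n} \<inter> S \<subseteq> T \<union> {..<k0}" unfolding T_def by auto
      hence "card ({..<n} \<inter> S) \<le> card (T \<union> {..<k0})" using finT by (intro card_mono) auto
      also have "\<dots> \<le> card T + card {..<k0}" by (rule card_Un_le)
      finally show ?thesis using n(1) by simp
    qed
    \<comment> \<open>Two shifts by one twelfth reduce the separation from 1 to \<open>5 / 6\<close>
      in units of \<open>b ^ (-n)\<close>, still more than the diameter
      \<open>2 / 3\<close>.\<close>
    have "\<exists>c\<in>F. dist c (word_point b T a g) < 1 / (12 * real b ^ n)" if "g \<in> Wd" for g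
      using dense[of g n] that bn unfolding Wd_def T_def closure_approachable by simp
    then obtain c where c: "\<And>g. g \<in> Wd \<Longrightarrow> c g \<in> F"
        "\<And>g. g \<in> Wd \<Longrightarrow> dist (c g) (word_point b T a g) < 1 / (12 * real b ^ n)"
      by metis
    have sep: "2 * r < dist (c g) (c g')" if "g \<in> Wd" "g' \<in> Wd" "g \<noteq> g'" for g g'
    proof -
      have "1 / real b ^ n \<le> dist (word_point b T a g) (word_point b T a g')"
        using that unfolding Wd_def T_def by (intro dist_word_point_ge[OF b W a]) auto
      also have "\<dots> \<le> dist (c g) (word_point b T a g) + dist (c g) (c g') + dist (c g') (word_point b T a g')"
        using dist_triangle[of "word_point b T a g" "word_point b T a g'" "c g"]
          dist_triangle[of "c g" "word_point b T a g'" "c g'"] by (simp add: dist_commute)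
      finally have "1 / real b ^ n < 2 * (1 / (12 * real b ^ n)) + dist (c g) (c g')"
        using c(2)[OF that(1)] c(2)[OF that(2)] by linarith
      moreover have "1 / (3 * real b ^ n) = 1 / real b ^ n / 3" "1 / (12 * real b ^ n) = 1 / real b ^ n / 12"
        by simp_all
      moreover have "0 < 1 / real b ^ n" using bn by simp
      ultimately show ?thesis unfolding r_def by linarith
    qed
    have r: "0 < r" "r \<le> \<delta>"
    proof -
      show "0 < r" unfolding r_def using bn by simp
      have "r \<le> (1 / real b) ^ n" unfolding r_def using bn by (simp add: power_one_over field_simps)
      thus "r \<le> \<delta>" using n(3) by simp
    qed
    have "B \<le> real (card Wd) * (2 * r) powr s"
    proof -
      have "real b powr (t * (\<theta> * real n - real k0)) \<le> real b powr (t * real (card T))"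
        using cardT t b by simp
      also have "\<dots> = real D ^ card T"
        unfolding Db using b by (simp add: powr_powr[symmetric] powr_realpow)
      also have "\<dots> = real (card Wd)" unfolding Wd_def D_def using finT by (simp add: card_PiE)
      finally have 1: "real b powr (t * (\<theta> * real n - real k0)) \<le> real (card Wd)" .
      have "(2 * r) powr s = (2 / 3 * (1 / real b ^ n)) powr s" unfolding r_def by simp
      also have "\<dots> = (2 / 3) powr s * (1 / real b ^ n) powr s" by (rule powr_mult)
      also have "(1 / real b ^ n) powr s = real b powr (- s * real n)"
        using b by (simp add: powr_divide powr_realpow[symmetric] powr_powr powr_minus_divide mult.commute)
      finally have 2: "(2 * r) powr s = (2 / 3) powr s * real b powr (- s * real n)" .
      have "B \<le> \<kappa> * (real b powr (t * \<theta> - s)) ^ n" using n(2) by simp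
      also have "(real b powr (t * \<theta> - s)) ^ n = real b powr ((t * \<theta> - s) * real n)"
        using b by (simp add: powr_powr[symmetric] powr_realpow)
      also have "\<kappa> * \<dots> = (real b powr (- t * real k0) * real b powr ((t * \<theta> - s) * real n)) * (2 / 3) powr s"
        unfolding \<kappa>_def by simp
      also have "real b powr (- t * real k0) * real b powr ((t * \<theta> - s) * real n) =
          real b powr (t * (\<theta> * real n - real k0)) * real b powr (- s * real n)"
        unfolding powr_add[symmetric] by (simp add: algebra_simps)
      also have "\<dots> * (2 / 3) powr s = real b powr (t * (\<theta> * real n - real k0)) * (2 * r) powr s"
        unfolding 2 by simp
      also have "\<dots> \<le> real (card Wd) * (2 * r) powr s" by (intro mult_right_mono 1) simp
      finally show ?thesis .
    qed
    hence "ennreal B \<le> ennreal (real (card Wd) * (2 * r) powr s)" by (rule ennreal_leI)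
    also have "\<dots> \<le> (SUP P \<in> {P. delta_packing \<delta> F P}. infsum (\<lambda>(x, r). ennreal ((2 * r) powr s)) P)"
      by (rule packing_pre_ge_of_separated) (use finWd r c sep in auto)
    finally show ?thesis .
  qed
  have "ennreal B \<le> packing_pre s F" if "0 < B" for B
    unfolding packing_pre_def by (rule INF_greatest) (use large that in auto)
  hence nat_le: "of_nat n \<le> packing_pre s F" for n
    by (cases "n = 0") (auto simp: ennreal_of_nat_eq_real_of_nat)
  show ?thesis
  proof (rule ccontr)
    assume "packing_pre s F \<noteq> \<infinity>"
    hence "packing_pre s F < top" by (simp add: top.not_eq_extremum)
    then obtain n where "packing_pre s F < of_nat n" using ennreal_Ex_less_of_nat by blast
    thus False using nat_le[of n] by simp
  qed
qed

text \<open>Indexed by a countable type, as needed for Baire and for countable intersections of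
  almost sure events. It is a genuine hyperplane exactly if \<open>snd p\<close> is not identically
  zero; otherwise a relation only asserts that a rational is 0.\<close>

definition rat_hyperplane :: "rat \<times> ('m::finite \<Rightarrow> rat) \<Rightarrow> (real ^ 'm) set" where
  "rat_hyperplane p = {x. of_rat (fst p) + (\<Sum>i\<in>UNIV. of_rat (snd p i) * x $ i) = (0 :: real)}"

lemma totally_irrational_iff:
  "totally_irrational x \<longleftrightarrow> (\<forall>p. (\<exists>i. snd p i \<noteq> 0) \<longrightarrow> x \<notin> rat_hyperplane p)"
proof
  assume "totally_irrational x"
  thus "\<forall>p. (\<exists>i. snd p i \<noteq> 0) \<longrightarrow> x \<notin> rat_hyperplane p"
    unfolding totally_irrational_def rat_hyperplane_def by auto
next
  assume *: "\<forall>p. (\<exists>i. snd p i \<noteq> 0) \<longrightarrow> x \<notin> rat_hyperplane p"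
  show "totally_irrational x"
    unfolding totally_irrational_def
  proof (intro allI impI)
    fix a0 a assume eq: "of_rat a0 + (\<Sum>i\<in>UNIV. of_rat (a i) * x $ i) = (0 :: real)"
    hence "\<forall>i. a i = 0" using *[rule_format, of "(a0, a)"] unfolding rat_hyperplane_def by auto
    thus "a0 = 0 \<and> (\<forall>i. a i = 0)" using eq by simp
  qed
qed

lemma closed_rat_hyperplane: "closed (rat_hyperplane p)"
  unfolding rat_hyperplane_def by (intro closed_Collect_eq continuous_intros)

section \<open>Category in digit products with free positions \<open>S\<close>\<close>

context
  fixes b :: nat and W :: "'m::finite \<Rightarrow> nat set" and V :: "'m \<Rightarrow> nat \<Rightarrow> nat set" and S :: "nat set"
  assumes b: "2 \<le> b" and W: "\<And>i. W i \<subseteq> {..<b}" and card: "\<And>i. 2 \<le> card (W i)"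
    and VW: "\<And>i k. V i k \<subseteq> W i" and Vne: "\<And>i k. V i k \<noteq> {}"
    and VS: "\<And>i k. k \<in> S \<Longrightarrow> V i k = W i"
begin

text \<open>Phrased for digit sequences because a point may have two expansions.\<close>

lemma digit_prod_cylinder_small:
  assumes "0 < e"
  shows "\<exists>k0. \<forall>x y a a'. (\<forall>i k. a i k \<in> V i k) \<and> (\<forall>i k. a' i k \<in> V i k) \<and>
    (\<forall>i. x $ i = digit_val b (a i)) \<and> (\<forall>i. y $ i = digit_val b (a' i)) \<and>
    (\<forall>i k. k < k0 \<longrightarrow> a i k = a' i k) \<longrightarrow> dist x (y :: real ^ 'm) < e"
proof -
  have "(\<lambda>k. real CARD('m) * (1 / real b) ^ k) \<longlonglongrightarrow> real CARD('m) * 0"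
    using b by (intro tendsto_intros LIMSEQ_realpow_zero) auto
  hence "\<forall>\<^sub>F k in sequentially. real CARD('m) * (1 / real b) ^ k < e"
    by (rule order_tendstoD(2)) (use assms in simp)
  then obtain k0 where k0: "real CARD('m) * (1 / real b) ^ k0 < e"
    by (auto dest: eventually_happens)
  show ?thesis
  proof (intro exI allI impI, elim conjE)
    fix x y :: "real ^ 'm" and a a'
    assume a: "\<forall>i k. a i k \<in> V i k" "\<forall>i k. a' i k \<in> V i k" "\<forall>i. x $ i = digit_val b (a i)"
      "\<forall>i. y $ i = digit_val b (a' i)" "\<forall>i k. k < k0 \<longrightarrow> a i k = a' i k"
    have "a i k < b" "a' i k < b" for i k using a(1,2) VW W by blast+
    hence "\<bar>x $ i - y $ i\<bar> \<le> 1 / real b ^ k0" for i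
      using a(3,4,5) by (auto intro!: digit_val_dist_le[OF b])
    hence "dist x y \<le> real CARD('m) * (1 / real b ^ k0)" by (rule dist_le_card_mult)
    thus "dist x y < e" using k0 by (simp add: power_one_over)
  qed
qed

text \<open>Changing one digit of coordinate \<open>i0\<close> at a remote free position moves the
  point slightly along an axis on which the linear form is not constant, hence off the
  hyperplane.\<close>

lemma digit_prod_dense_off_hyperplane:
  assumes S: "infinite S" and p: "snd p i0 \<noteq> 0"
  shows "digit_prod b V \<subseteq> closure (digit_prod b V - rat_hyperplane p)"
proof
  fix x :: "real ^ 'm" assume x: "x \<in> digit_prod b V"
  obtain a where a: "\<And>i k. a i k \<in> V i k" "\<And>i. x $ i = digit_val b (a i)"
    using x digit_prodE by blast
  show "x \<in> closure (digit_prod b V - rat_hyperplane p)"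
  proof (cases "x \<in> rat_hyperplane p")
    case False
    thus ?thesis using x by (intro subsetD[OF closure_subset]) simp
  next
    case True
    show ?thesis
      unfolding closure_approachable
    proof (intro allI impI)
      fix e :: real assume "e > 0"
      obtain k0 where k0: "\<forall>x y a a'. (\<forall>i k. a i k \<in> V i k) \<and> (\<forall>i k. a' i k \<in> V i k) \<and>
          (\<forall>i. x $ i = digit_val b (a i)) \<and> (\<forall>i. y $ i = digit_val b (a' i)) \<and>
          (\<forall>i k. k < k0 \<longrightarrow> a i k = a' i k) \<longrightarrow> dist x (y :: real ^ 'm) < e"
        using digit_prod_cylinder_small[OF \<open>e > 0\<close>] by blast
      obtain k where k: "k \<in> S" "k0 \<le> k" using S by (meson infinite_nat_iff_unbounded_le)
      have "\<exists>d\<in>W i0. d \<noteq> a i0 k"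
      proof (rule ccontr)
        assume "\<not> ?thesis"
        hence "W i0 \<subseteq> {a i0 k}" by blast
        hence "card (W i0) \<le> card {a i0 k}" by (intro card_mono) simp
        thus False using card[of i0] by simp
      qed
      then obtain d where d: "d \<in> W i0" "d \<noteq> a i0 k" by blast
      define a' where "a' i = (if i = i0 then (a i)(k := d) else a i)" for i
      have a': "a' i j \<in> V i j" for i j using a(1) d(1) VS[OF k(1)] unfolding a'_def by auto
      define y :: "real ^ 'm" where "y = (\<chi> i. digit_val b (a' i))"
      have yE: "y \<in> digit_prod b V" unfolding y_def by (rule digit_prodI[OF a'])
      have "dist y x < e"
        by (rule k0[THEN spec[of _ y], THEN spec[of _ x], THEN spec[of _ a'], THEN spec[of _ a], THEN mp])
          (use a a' k in \<open>auto simp: y_def a'_def\<close>)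
      moreover have "y \<notin> rat_hyperplane p"
      proof
        assume "y \<in> rat_hyperplane p"
        hence "(\<Sum>i\<in>UNIV. of_rat (snd p i) * y $ i) - (\<Sum>i\<in>UNIV. of_rat (snd p i) * x $ i) = (0 :: real)"
          using True unfolding rat_hyperplane_def by simp
        moreover have "(\<Sum>i\<in>UNIV. of_rat (snd p i) * y $ i) - (\<Sum>i\<in>UNIV. of_rat (snd p i) * x $ i) =
            (\<Sum>i\<in>UNIV. if i = i0 then of_rat (snd p i0) * (y $ i0 - x $ i0) else 0)"
          unfolding sum_subtractf[symmetric]
          by (rule sum.cong) (auto simp: y_def a'_def a(2) algebra_simps)
        ultimately have "y $ i0 = x $ i0" using p by simp
        moreover have "y $ i0 = x $ i0 + (real d - real (a i0 k)) / real b ^ Suc k"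
        proof -
          have "a i0 j < b" for j using a(1)[of i0 j] VW W by blast
          moreover have "d < b" using d W by blast
          ultimately show ?thesis unfolding y_def a'_def using a(2) digit_val_fun_upd[OF b] by simp
        qed
        ultimately show False using d(2) b by simp
      qed
      ultimately show "\<exists>y\<in>digit_prod b V - rat_hyperplane p. dist y x < e" using yE by blast
    qed
  qed
qed

text \<open>By Baire's theorem, if countably many sets cover the totally irrational points of the compact set
  \<open>digit_prod b V\<close>, one of them is dense in a cylinder.\<close>

lemma packing_measure_totally_irrational:
  assumes freq: "\<exists>\<^sub>F n in sequentially. \<theta> * real n \<le> real (Finite_Set.card ({..<n} \<inter> S))"
    and S: "infinite S"
    and s: "0 \<le> s" "s < \<theta> * cantor_dim b W"
  shows "packing_measure s {x \<in> digit_prod b V. totally_irrational x} = \<infinity>"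
proof -
  define E where "E = digit_prod b V"
  have "(\<Sum>i. packing_pre s (F i)) = \<infinity>"
    if cover: "{x \<in> E. totally_irrational x} \<subseteq> (\<Union>i. F i)" for F :: "nat \<Rightarrow> (real ^ 'm) set"
  proof -
    have clE: "closed E"
      unfolding E_def using VW W b by (intro compact_imp_closed compact_digit_prod) blast+
    have "V i k \<noteq> {}" for i k by (rule Vne)
    hence "(SOME d. d \<in> V i k) \<in> V i k" for i k by (simp add: some_in_eq)
    hence Ene: "E \<noteq> {}" unfolding E_def using digit_prodI[of "\<lambda>i k. SOME d. d \<in> V i k"] by blast
    have "\<exists>i. \<not> E \<subseteq> closure (E - closure (F i))"
    proof (rule ccontr)
      assume "\<not> ?thesis"
      hence dense: "\<And>i. E \<subseteq> closure (E - closure (F i))" by blast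
      \<comment> \<open>A point in all members of \<open>G\<close> would be totally irrational and
        lie in no \<open>F i\<close>, against \<open>cover\<close>.\<close>
      define G where "G = range (\<lambda>i. E - closure (F i)) \<union>
        (\<lambda>p. E - rat_hyperplane p) ` {p. \<exists>i. snd p i \<noteq> 0}"
      have "E \<subseteq> closure (\<Inter>G)"
      proof (rule Baire[OF clE])
        show "countable G" unfolding G_def by auto
        have op: "openin (top_of_set E) (E - C)" if "closed C" for C
          using that by (metis Diff_eq openin_open_Int open_Compl)
        fix T assume "T \<in> G"
        then consider i where "T = E - closure (F i)"
          | p i where "T = E - rat_hyperplane p" "snd p i \<noteq> 0"
          unfolding G_def by blast
        thus "openin (top_of_set E) T \<and> E \<subseteq> closure T"
        proof cases
          case 1
          thus ?thesis using op dense by simp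
        next
          case 2
          show ?thesis
            unfolding 2(1) using op[OF closed_rat_hyperplane]
              digit_prod_dense_off_hyperplane[OF S 2(2)] unfolding E_def by simp
        qed
      qed
      hence "\<Inter>G \<noteq> {}" using Ene by auto
      then obtain x where x: "x \<in> \<Inter>G" by blast
      have "x \<in> E" using x unfolding G_def by auto
      moreover have "totally_irrational x"
        using x unfolding totally_irrational_iff G_def by blast
      ultimately obtain i where "x \<in> F i" using cover by blast
      moreover have "x \<notin> closure (F i)" using x unfolding G_def by auto
      ultimately show False using closure_subset by blast
    qed
    \<comment> \<open>So all points of \<open>E\<close> near \<open>x\<close> lie in
      \<open>closure (F i)\<close>.\<close>
    then obtain i x where x: "x \<in> E" "x \<notin> closure (E - closure (F i))" by blast
    then obtain e where e: "e > 0" "\<And>y. y \<in> E \<Longrightarrow> dist y x < e \<Longrightarrow> y \<in> closure (F i)"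
      unfolding closure_approachable[of x] by blast
    obtain k0 where k0: "\<forall>x y a a'. (\<forall>i k. a i k \<in> V i k) \<and> (\<forall>i k. a' i k \<in> V i k) \<and>
        (\<forall>i. x $ i = digit_val b (a i)) \<and> (\<forall>i. y $ i = digit_val b (a' i)) \<and>
        (\<forall>i k. k < k0 \<longrightarrow> a i k = a' i k) \<longrightarrow> dist x (y :: real ^ 'm) < e"
      using digit_prod_cylinder_small[OF e(1)] by blast
    obtain a where a: "\<And>i k. a i k \<in> V i k" "\<And>i. x $ i = digit_val b (a i)"
      using x(1) digit_prodE unfolding E_def by blast
    \<comment> \<open>The digits of \<open>x\<close> serve as background; fixing the first
      \<open>k0\<close> of them keeps every word point in that neighbourhood.\<close>
    have "packing_pre s (F i) = \<infinity>"
    proof (rule packing_pre_eq_top[OF b W card _ freq s])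
      show "a i k < b" for i k using a(1)[of i k] VW W by blast
      fix n g assume g: "g \<in> Pi\<^sub>E (S \<inter> {k0..<n}) (\<lambda>_. Pi\<^sub>E UNIV W)"
      define T where "T = S \<inter> {k0..<n}"
      have dig: "(if k \<in> T then g k i else a i k) \<in> V i k" for i k
        using g a(1) VS unfolding T_def by (auto simp: PiE_def Pi_def)
      hence "word_point b T a g \<in> E" unfolding word_point_def E_def by (intro digit_prodI)
      moreover have "dist (word_point b T a g) x < e"
        by (rule k0[THEN spec[of _ "word_point b T a g"], THEN spec[of _ x],
              THEN spec[of _ "\<lambda>i k. if k \<in> T then g k i else a i k"], THEN spec[of _ a], THEN mp])
          (use dig a in \<open>auto simp: word_point_def T_def\<close>)
      ultimately show "word_point b (S \<inter> {k0..<n}) a g \<in> closure (F i)"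
        using e(2) unfolding T_def by blast
    qed
    moreover have "packing_pre s (F i) \<le> (\<Sum>i. packing_pre s (F i))"
      using sum_le_suminf[of "\<lambda>i. packing_pre s (F i)" "{i}"] by simp
    ultimately show ?thesis by (simp add: top_unique)
  qed
  hence "(\<infinity> :: ennreal) \<le> packing_measure s {x \<in> digit_prod b V. totally_irrational x}"
    unfolding packing_measure_def E_def by (intro INF_greatest) auto
  thus ?thesis by (simp add: top_unique)
qed

lemma packing_dim_totally_irrational:
  assumes freq: "\<exists>\<^sub>F n in sequentially. \<theta> * real n \<le> real (Finite_Set.card ({..<n} \<inter> S))"
    and S: "infinite S"
  shows "ereal (\<theta> * cantor_dim b W) \<le> packing_dim {x \<in> digit_prod b V. totally_irrational x}"
  unfolding packing_dim_def
proof (rule Inf_greatest)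
  fix z assume "z \<in> {ereal s |s. 0 \<le> s \<and>
    packing_measure s {x \<in> digit_prod b V. totally_irrational x} = 0}"
  then obtain s where s: "z = ereal s" "0 \<le> s"
      "packing_measure s {x \<in> digit_prod b V. totally_irrational x} = 0" by blast
  show "ereal (\<theta> * cantor_dim b W) \<le> z"
  proof (rule ccontr)
    assume "\<not> ?thesis"
    hence "s < \<theta> * cantor_dim b W" unfolding s(1) by simp
    from packing_measure_totally_irrational[OF freq S s(2) this] show False using s(3) by simp
  qed
qed

end

section \<open>Fibres of digit projections\<close>

lemma Rats_borel: "(\<rat> :: real set) \<in> sets borel"
  by (rule sets.countable[OF _ countable_rat]) simp

section \<open>Translation invariance and null sets of Hausdorff measure\<close>

lemma diameter_translation_le:
  fixes U :: "'a::real_normed_vector set"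
  assumes "bounded U"
  shows "diameter ((+) t ` U) \<le> diameter U"
proof (rule diameter_le)
  show "(+) t ` U \<noteq> {} \<or> 0 \<le> diameter U" using diameter_ge_0[OF assms] by simp
  show "norm (x - y) \<le> diameter U" if xy: "x \<in> (+) t ` U" "y \<in> (+) t ` U" for x y
  proof -
    obtain x' y' where "x = t + x'" "y = t + y'" "x' \<in> U" "y' \<in> U" using xy by blast
    thus ?thesis using diameter_bounded_bound[OF assms, of x' y'] by (simp add: dist_norm)
  qed
qed

lemma hausdorff_outer_translation_le:
  fixes A :: "'a::real_normed_vector set"
  assumes "0 \<le> s"
  shows "hausdorff_outer s ((+) t ` A) \<le> hausdorff_outer s A"
  unfolding hausdorff_outer_def
proof (rule SUP_mono')
  fix \<delta> :: real
  show "hausdorff_pre s \<delta> ((+) t ` A) \<le> hausdorff_pre s \<delta> A"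
    unfolding hausdorff_pre_def
  proof (rule INF_mono)
    fix U assume "U \<in> {U :: nat \<Rightarrow> 'a set. A \<subseteq> (\<Union>i. U i) \<and> (\<forall>i. bounded (U i) \<and> diameter (U i) \<le> \<delta>)}"
    hence U: "A \<subseteq> (\<Union>i. U i)" "\<And>i. bounded (U i)" "\<And>i. diameter (U i) \<le> \<delta>" by auto
    have bd: "bounded ((+) t ` U i)" for i using U(2) bounded_translation by blast
    have "diam_pow s ((+) t ` U i) \<le> diam_pow s (U i)" for i
      using diameter_translation_le[OF U(2), of t i] diameter_ge_0[OF bd, of i] assms
      unfolding diam_pow_def by (auto intro!: ennreal_leI powr_mono2)
    hence "(\<Sum>i. diam_pow s ((+) t ` U i)) \<le> (\<Sum>i. diam_pow s (U i))"
      by (intro suminf_le) auto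
    moreover have "(+) t ` A \<subseteq> (\<Union>i. (+) t ` U i)" using U(1) by blast
    moreover have "diameter ((+) t ` U i) \<le> \<delta>" for i
      using diameter_translation_le[OF U(2), of t i] U(3)[of i] by linarith
    ultimately show "\<exists>V\<in>{V. (+) t ` A \<subseteq> (\<Union>i. V i) \<and> (\<forall>i. bounded (V i) \<and> diameter (V i) \<le> \<delta>)}.
        (\<Sum>i. diam_pow s (V i)) \<le> (\<Sum>i. diam_pow s (U i))"
      using bd by (intro bexI[of _ "\<lambda>i. (+) t ` U i"]) auto
  qed
qed

lemma hausdorff_outer_translation:
  fixes A :: "'a::real_normed_vector set"
  assumes "0 \<le> s"
  shows "hausdorff_outer s ((+) t ` A) = hausdorff_outer s A"
proof (rule antisym)
  show "hausdorff_outer s ((+) t ` A) \<le> hausdorff_outer s A"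
    by (rule hausdorff_outer_translation_le[OF assms])
  have "(+) (- t) ` ((+) t ` A) = A" by (force simp: image_image)
  thus "hausdorff_outer s A \<le> hausdorff_outer s ((+) t ` A)"
    using hausdorff_outer_translation_le[OF assms, of "- t" "(+) t ` A"] by simp
qed

lemma hausdorff_outer_singleton:
  assumes "0 < s"
  shows "hausdorff_outer s {x} = 0"
proof -
  have "hausdorff_pre s \<delta> {x} \<le> 0" if "0 < \<delta>" for \<delta>
  proof -
    define U where "U i = (if i = 0 then {x} else {})" for i :: nat
    have "hausdorff_pre s \<delta> {x} \<le> (\<Sum>i. diam_pow s (U i))"
      unfolding hausdorff_pre_def by (rule INF_lower) (use that in \<open>auto simp: U_def\<close>)
    also have "(\<lambda>i. diam_pow s (U i)) = (\<lambda>_. 0)" using assms by (auto simp: U_def diam_pow_def)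
    also have "(\<Sum>i. 0 :: ennreal) = 0" by simp
    finally show ?thesis .
  qed
  thus ?thesis unfolding hausdorff_outer_def by (auto intro!: antisym SUP_least)
qed

lemma sets_hausdorff_measure [simp]: "sets (hausdorff_measure s) = sets borel"
  unfolding hausdorff_measure_def
  by (subst sets_measure_of) (auto simp: sets.sigma_sets_eq[of borel, simplified])

text \<open>\<open>measure_of\<close> yields the zero measure if the outer measure is not \<open>\<sigma>\<close>-additive; both cases are harmless
  below, so Caratheodory's theorem is avoided.\<close>

lemma emeasure_hausdorff_measure:
  assumes "A \<in> sets borel"
  shows "emeasure (hausdorff_measure s) A =
    (if measure_space UNIV (sets borel) (hausdorff_outer s :: 'a::metric_space set \<Rightarrow> ennreal)
     then hausdorff_outer s (A :: 'a set) else 0)"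
  using assms unfolding hausdorff_measure_def
  by (subst emeasure_measure_of_conv) (simp add: sets.sigma_sets_eq[of borel, simplified])

lemma emeasure_hausdorff_measure_singleton:
  "0 < s \<Longrightarrow> emeasure (hausdorff_measure s) {x} = 0"
  by (simp add: emeasure_hausdorff_measure hausdorff_outer_singleton)

lemma emeasure_hausdorff_measure_countable:
  fixes A :: "'a::metric_space set"
  assumes "0 < s" "countable A"
  shows "emeasure (hausdorff_measure s) A = 0"
proof -
  have "(\<Union>x\<in>A. {x}) \<in> null_sets (hausdorff_measure s)"
    using assms emeasure_hausdorff_measure_singleton[OF assms(1)]
    by (intro null_sets_UN' null_setsI) auto
  thus ?thesis by (simp add: null_sets_def)
qed

lemma sets_borel_translation:
  fixes A :: "'a::real_normed_vector set"
  assumes "A \<in> sets borel"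
  shows "(+) t ` A \<in> sets borel"
proof -
  have "(+) t ` A = (\<lambda>x. x - t) -` A \<inter> space borel" by (force simp: image_iff algebra_simps)
  also have "\<dots> \<in> sets borel"
    using assms by (intro measurable_sets[where A = borel])
      (auto intro!: borel_measurable_continuous_onI continuous_intros)
  finally show ?thesis .
qed

lemma emeasure_hausdorff_measure_translation:
  fixes A :: "'a::real_normed_vector set"
  assumes "0 \<le> s" "A \<in> sets borel"
  shows "emeasure (hausdorff_measure s) ((+) t ` A) = emeasure (hausdorff_measure s) A"
  using assms by (simp add: emeasure_hausdorff_measure sets_borel_translation hausdorff_outer_translation)

text \<open>Masks the digits outside \<open>S\<close>. Reading digits through floors makes it a
  Borel function on all reals; of a number with two expansions the floors see the terminating
  one.\<close>

definition digit_proj :: "nat \<Rightarrow> nat set \<Rightarrow> real \<Rightarrow> real" where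
  "digit_proj b S t = digit_val b (\<lambda>k. if k \<in> S then nat (\<lfloor>real b ^ Suc k * t\<rfloor> mod int b) else 0)"

lemma borel_measurable_digit_proj: "digit_proj b S \<in> borel_measurable borel"
proof -
  have "(\<lambda>t. if k \<in> S then real (nat (\<lfloor>real b ^ Suc k * t\<rfloor> mod int b)) / real b ^ Suc k else 0)
      \<in> borel_measurable borel" for k
  proof (cases "k \<in> S")
    case True
    have "(\<lambda>t. \<lfloor>real b ^ Suc k * t\<rfloor>) \<in> measurable borel (count_space UNIV)"
      by (rule measurable_compose[OF _ measurable_real_floor]) measurable
    hence "(\<lambda>t. real (nat (\<lfloor>real b ^ Suc k * t\<rfloor> mod int b)) / real b ^ Suc k) \<in> borel_measurable borel"
      by (rule measurable_compose) simp
    thus ?thesis using True by simp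
  qed simp
  hence "(\<lambda>t. \<Sum>k. if k \<in> S then real (nat (\<lfloor>real b ^ Suc k * t\<rfloor> mod int b)) / real b ^ Suc k else 0)
      \<in> borel_measurable borel"
    by (rule borel_measurable_suminf)
  moreover have "digit_proj b S =
      (\<lambda>t. \<Sum>k. if k \<in> S then real (nat (\<lfloor>real b ^ Suc k * t\<rfloor> mod int b)) / real b ^ Suc k else 0)"
    unfolding digit_proj_def digit_val_def by (intro ext suminf_cong) auto
  ultimately show ?thesis by simp
qed

lemma digit_eq_floor:
  assumes b: "2 \<le> b" and a: "\<And>k. a k < b" and nt: "\<And>n. digit_val b (\<lambda>k. a (n + k)) \<noteq> 1"
  shows "a k = nat (\<lfloor>real b ^ Suc k * digit_val b a\<rfloor> mod int b)"
proof -
  have "\<lfloor>real b ^ Suc k * digit_val b a\<rfloor> = int (b * digit_pre b a k + a k)"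
    using digit_pre_eq_floor[OF b a nt, of "Suc k"] by simp
  also have "\<dots> mod int b = int ((b * digit_pre b a k + a k) mod b)" by (simp only: zmod_int)
  also have "(b * digit_pre b a k + a k) mod b = a k" using a[of k] by simp
  finally show ?thesis by simp
qed

lemma digit_eq_floor_irrational:
  assumes b: "2 \<le> b" and a: "\<And>k. a k < b" and irr: "digit_val b a \<notin> \<rat>"
  shows "a k = nat (\<lfloor>real b ^ Suc k * digit_val b a\<rfloor> mod int b)"
proof (rule digit_eq_floor[OF b a])
  fix n
  show "digit_val b (\<lambda>k. a (n + k)) \<noteq> 1"
  proof
    assume "digit_val b (\<lambda>k. a (n + k)) = 1"
    hence "real b ^ n * digit_val b a = real (digit_pre b a n) + 1"
      using digit_val_shift[of b a n] b a by simp
    hence "digit_val b a = (real (digit_pre b a n) + 1) / real b ^ n"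
      using b by (simp add: field_simps)
    hence "digit_val b a \<in> \<rat>" by (simp add: Rats_divide Rats_power)
    thus False using irr by simp
  qed
qed

lemma digit_proj_digit_val:
  assumes "2 \<le> b" "\<And>k. a k < b" "digit_val b a \<notin> \<rat>"
  shows "digit_proj b S (digit_val b a) = digit_val b (\<lambda>k. if k \<in> S then a k else 0)"
  unfolding digit_proj_def using digit_eq_floor_irrational[OF assms] by (simp cong: if_cong)

text \<open>The masked sequences vanish at infinitely many positions, so no tail consists of digits
  \<open>b - 1\<close> and floors recover them, even if the masked value is rational.\<close>

lemma digits_determined_by_digit_proj:
  assumes b: "2 \<le> b" and a: "\<And>k. a k < b" "\<And>k. a' k < b" and S: "infinite (- S)"
    and eq: "digit_val b (\<lambda>k. if k \<in> S then a k else 0) = digit_val b (\<lambda>k. if k \<in> S then a' k else 0)"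
    and k: "k \<in> S"
  shows "a k = a' k"
proof -
  define cut where "cut c k = (if k \<in> S then c k else 0)" for c :: "nat \<Rightarrow> nat" and k
  have nt: "digit_val b (\<lambda>k. cut c (n + k)) \<noteq> 1" if c: "\<And>k. c k < b" for c n
  proof
    assume v: "digit_val b (\<lambda>k. cut c (n + k)) = 1"
    have "cut c k < b" for k using c b unfolding cut_def by simp
    hence *: "cut c (n + k) = b - 1" for k
      using digit_val_eq_1_iff[of b "\<lambda>k. cut c (n + k)"] b v by simp
    obtain j where "j \<in> - S" "n \<le> j" using S by (meson infinite_nat_iff_unbounded_le)
    thus False using *[of "j - n"] b unfolding cut_def by simp
  qed
  have "cut a k < b" "cut a' k < b" for k using a b unfolding cut_def by auto
  hence "cut a k = cut a' k"
    using digit_eq_floor[of b "cut a", OF b _ nt[OF a(1)], of k]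
      digit_eq_floor[of b "cut a'", OF b _ nt[OF a(2)], of k] eq
    unfolding cut_def by simp
  thus ?thesis using k unfolding cut_def by simp
qed

lemma emeasure_zero_if_infinitely_many_disjoint_copies:
  assumes S: "infinite S" and T: "\<And>k. k \<in> S \<Longrightarrow> T k \<in> sets M" "\<And>k. k \<in> S \<Longrightarrow> emeasure M (T k) = m"
    and sub: "\<And>k. k \<in> S \<Longrightarrow> T k \<subseteq> C" and disj: "disjoint_family_on T S"
    and C: "C \<in> sets M" "emeasure M C \<noteq> \<infinity>"
  shows "m = 0"
proof (rule ccontr)
  assume "m \<noteq> 0"
  have le: "of_nat n * m \<le> emeasure M C" for n
  proof -
    obtain F where F: "F \<subseteq> S" "finite F" "card F = n"
      using infinite_arbitrarily_large[OF S] by blast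
    have "of_nat n * m = (\<Sum>k\<in>F. emeasure M (T k))" using F T(2) by (simp add: subset_iff)
    also have "\<dots> = emeasure M (\<Union>k\<in>F. T k)"
      using F T(1) disj by (intro sum_emeasure) (auto intro: disjoint_family_on_mono)
    also have "\<dots> \<le> emeasure M C" using F sub C by (intro emeasure_mono) auto
    finally show ?thesis .
  qed
  obtain c where c: "emeasure M C = ennreal c" "0 \<le> c" using C(2) by (cases "emeasure M C") auto
  obtain r where r: "m = ennreal r" "0 < r"
  proof -
    have "m \<le> ennreal c" using le[of 1] c by simp
    then obtain r where "m = ennreal r" "0 \<le> r" using ennreal_cases top_unique by (metis ennreal_neq_top)
    thus ?thesis using that \<open>m \<noteq> 0\<close> by (cases "r = 0") auto
  qed
  obtain n where "c / r < real n" using reals_Archimedean2 by blast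
  hence "c < real n * r" using r by (simp add: field_simps)
  moreover have "ennreal (real n * r) \<le> ennreal c"
    using le[of n] unfolding r c using r(2) by (simp add: ennreal_mult ennreal_of_nat_eq_real_of_nat)
  ultimately show False using c(2) by simp
qed

section \<open>The natural measure of a single Cantor set\<close>

context
  fixes b :: nat and W :: "nat set"
  assumes b: "2 \<le> b" and W: "W \<subseteq> {..<b}" and cardW: "2 \<le> card W"
begin

private abbreviation "sW \<equiv> ln (real (card W)) / ln (real b)"

private lemma sW: "0 < sW"
  using b cardW by simp

lemma cantor_set_borel: "cantor_set b W \<in> sets borel"
  unfolding cantor_set_eq_digit_set
  using b W by (intro borel_compact compact_digit_set) auto

lemma sets_cantor_measure: "sets (cantor_measure b W) = sets borel"
  unfolding cantor_measure_def by simp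

lemma emeasure_cantor_measure:
  assumes "A \<in> sets borel"
  shows "emeasure (cantor_measure b W) A =
    emeasure (hausdorff_measure sW) (cantor_set b W \<inter> A) / emeasure (hausdorff_measure sW) (cantor_set b W)"
  unfolding cantor_measure_def using assms cantor_set_borel by (intro emeasure_uniform_measure) auto

lemma finite_measure_cantor_measure: "finite_measure (cantor_measure b W)"
proof (rule finite_measureI)
  define m where "m = emeasure (hausdorff_measure sW) (cantor_set b W)"
  have "space (cantor_measure b W) = UNIV"
    using sets_eq_imp_space_eq[OF sets_cantor_measure] by simp
  hence "emeasure (cantor_measure b W) (space (cantor_measure b W)) = m / m"
    unfolding m_def by (simp add: emeasure_cantor_measure)
  \<comment> \<open>In \<open>ennreal\<close> both \<open>0 / 0\<close> and
    \<open>\<infinity> / \<infinity>\<close> are 0, so the quotient is finite for every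
    \<open>m\<close>.\<close>
  also have "\<dots> \<noteq> \<infinity>"
    by (cases "m = 0 \<or> m = \<infinity>") (auto simp: top.not_eq_extremum)
  finally show "emeasure (cantor_measure b W) (space (cantor_measure b W)) \<noteq> \<infinity>" .
qed

lemma emeasure_cantor_measure_Compl: "emeasure (cantor_measure b W) (- cantor_set b W) = 0"
  using cantor_set_borel by (subst emeasure_cantor_measure) auto

lemma emeasure_cantor_measure_Rats: "emeasure (cantor_measure b W) \<rat> = 0"
proof -
  have c: "countable (cantor_set b W \<inter> \<rat>)" using countable_rat by (rule countable_subset[rotated]) auto
  hence "emeasure (hausdorff_measure sW) (cantor_set b W \<inter> \<rat>) = 0"
    using emeasure_hausdorff_measure_countable[OF sW] by blast
  moreover have "(\<rat> :: real set) \<in> sets borel"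
    by (rule Rats_borel)
  ultimately show ?thesis by (simp add: emeasure_cantor_measure)
qed

text \<open>Altering one digit at a position in \<open>S\<close> translates the fibre of \<open>digit_proj b S\<close> inside the Cantor
  set, and the translates for distinct positions are disjoint.\<close>

lemma emeasure_cantor_measure_digit_proj_fibre:
  assumes S: "infinite S" "infinite (- S)"
  shows "emeasure (cantor_measure b W) (digit_proj b S -` {\<beta>}) = 0"
proof -
  define M :: "real measure" where "M = hausdorff_measure sW"
  define C where "C = cantor_set b W"
  \<comment> \<open>Without the rationals every point has a single expansion, which
    \<open>dg\<close> reads off.\<close>
  define B where "B = C \<inter> digit_proj b S -` {\<beta>} - \<rat>"
  have fib: "digit_proj b S -` {\<beta>} \<in> sets borel"
    using measurable_sets[OF borel_measurable_digit_proj, of "{\<beta>}" b S] by simp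
  have rat: "(\<rat> :: real set) \<in> sets borel" by (rule Rats_borel)
  have C: "C \<in> sets borel" unfolding C_def by (rule cantor_set_borel)
  have B: "B \<in> sets borel" unfolding B_def using fib rat C by auto
  have digB: "\<exists>a. (\<forall>k. a k \<in> W) \<and> t = digit_val b a" if "t \<in> C" for t
    using that unfolding C_def cantor_set_eq_digit_set digit_set_def by auto
  define dg where "dg t k = nat (\<lfloor>real b ^ Suc k * t\<rfloor> mod int b)" for t k
  have dg: "dg (digit_val b a) k = a k" if "\<forall>k. a k \<in> W" "digit_val b a \<notin> \<rat>" for a k
    unfolding dg_def
    by (rule digit_eq_floor_irrational[OF b _ that(2), symmetric]) (use that(1) W in blast)
  have null: "emeasure M B = 0" if fin: "emeasure M C \<noteq> \<infinity>"
  proof (cases "B = {}")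
    case False
    then obtain t0 where t0: "t0 \<in> B" by blast
    have same: "dg t k = dg t0 k" if t: "t \<in> B" and k: "k \<in> S" for t k
    proof -
      obtain a where a: "\<forall>k. a k \<in> W" "t = digit_val b a" using digB t unfolding B_def by blast
      obtain a0 where a0: "\<forall>k. a0 k \<in> W" "t0 = digit_val b a0" using digB t0 unfolding B_def by blast
      have lt: "a k < b" "a0 k < b" for k using a(1) a0(1) W by blast+
      have irr: "digit_val b a \<notin> \<rat>" "digit_val b a0 \<notin> \<rat>" using t t0 a a0 unfolding B_def by auto
      have "digit_proj b S t = digit_proj b S t0" using t t0 unfolding B_def by simp
      hence "a k = a0 k"
        unfolding a(2) a0(2) using digit_proj_digit_val[of b a S, OF b lt(1) irr(1)]
          digit_proj_digit_val[of b a0 S, OF b lt(2) irr(2)]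
        by (intro digits_determined_by_digit_proj[OF b lt S(2) _ k]) simp
      thus ?thesis unfolding a(2) a0(2) using dg[OF a(1) irr(1)] dg[OF a0(1) irr(2)] by simp
    qed
    have "\<exists>c\<in>W. c \<noteq> dg t0 k" for k
    proof (rule ccontr)
      assume "\<not> ?thesis"
      hence "W \<subseteq> {dg t0 k}" by blast
      hence "card W \<le> card {dg t0 k}" by (intro card_mono) simp
      thus False using cardW by simp
    qed
    then obtain c where c: "\<And>k. c k \<in> W" "\<And>k. c k \<noteq> dg t0 k" by metis
    \<comment> \<open>All points of \<open>B\<close> share the digit \<open>dg t0 k\<close> at
      \<open>k\<close>, so one translation replaces it by \<open>c k\<close> throughout
      \<open>B\<close>.\<close>
    define T where "T k = (+) ((real (c k) - real (dg t0 k)) / real b ^ Suc k) ` B" for k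
    have T: "\<exists>a. (\<forall>j. a j \<in> W) \<and> u = digit_val b (a(k := c k)) \<and> u \<notin> \<rat> \<and>
        (\<forall>j\<in>S. a j = dg t0 j)" if u: "u \<in> T k" and k: "k \<in> S" for u k
    proof -
      obtain t where t: "t \<in> B" "u = (real (c k) - real (dg t0 k)) / real b ^ Suc k + t"
        using u unfolding T_def by blast
      obtain a where a: "\<forall>k. a k \<in> W" "t = digit_val b a" using digB t(1) unfolding B_def by blast
      have irr: "t \<notin> \<rat>" using t(1) unfolding B_def by blast
      have aj: "a j = dg t0 j" if "j \<in> S" for j
        using dg[OF a(1), of j] same[OF t(1) that] irr a(2) by simp
      have "a j < b" "c k < b" for j using a(1) c(1) W by blast+
      hence "u = digit_val b (a(k := c k))"
        using digit_val_fun_upd[of b a "c k" k] b aj[OF k] unfolding t(2) a(2) by simp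
      moreover have "u \<notin> \<rat>"
      proof
        assume "u \<in> \<rat>"
        hence "u - (real (c k) - real (dg t0 k)) / real b ^ Suc k \<in> \<rat>"
          by (intro Rats_diff Rats_divide Rats_power Rats_of_nat)
        thus False using irr unfolding t(2) by simp
      qed
      ultimately show ?thesis using a(1) aj by blast
    qed
    show ?thesis
    proof (rule emeasure_zero_if_infinitely_many_disjoint_copies[OF S(1)])
      show "T k \<in> sets M" for k unfolding T_def M_def using sets_borel_translation[OF B] by simp
      show "emeasure M (T k) = emeasure M B" for k
        unfolding T_def M_def using sW B by (intro emeasure_hausdorff_measure_translation) auto
      show "T k \<subseteq> C" if "k \<in> S" for k
      proof
        fix u assume "u \<in> T k"
        from T[OF this that] obtain a where "\<forall>j. a j \<in> W" "u = digit_val b (a(k := c k))" by blast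
        moreover have "(a(k := c k)) j \<in> W" for j using calculation(1) c(1) by simp
        ultimately show "u \<in> C" unfolding C_def cantor_set_eq_digit_set digit_set_def by blast
      qed
      show "disjoint_family_on T S"
        unfolding disjoint_family_on_def
      proof (intro ballI impI)
        fix k l assume kl: "k \<in> S" "l \<in> S" "k \<noteq> l"
        have False if u: "u \<in> T k" "u \<in> T l" for u
        proof -
          obtain a where a: "\<forall>j. a j \<in> W" "u = digit_val b (a(k := c k))" "u \<notin> \<rat>"
            using T[OF u(1) kl(1)] by blast
          obtain a' where a': "\<forall>j. a' j \<in> W" "u = digit_val b (a'(l := c l))" "\<forall>j\<in>S. a' j = dg t0 j"
            using T[OF u(2) kl(2)] by blast
          \<comment> \<open>Membership in \<open>T k\<close> makes the digit of \<open>u\<close> at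
            \<open>k\<close> equal to \<open>c k\<close>; membership in \<open>T l\<close> leaves it
            at the common value \<open>dg t0 k\<close>.\<close>
          have "dg u k = (a(k := c k)) k"
            unfolding a(2) by (rule dg) (use a c(1) in auto)
          moreover have "dg u k = (a'(l := c l)) k"
            unfolding a'(2) by (rule dg) (use a' a(3) c(1) in auto)
          ultimately show False using kl a'(3) c(2)[of k] by simp
        qed
        thus "T k \<inter> T l = {}" by blast
      qed
      show "C \<in> sets M" unfolding M_def using C by simp
    qed (use fin in auto)
  qed (simp)
  show ?thesis
  proof (cases "emeasure M C = \<infinity>")
    \<comment> \<open>The normalisation divides by infinity, which gives 0.\<close>
    case True
    thus ?thesis using fib unfolding M_def C_def by (simp add: emeasure_cantor_measure)
  next
    case False
    have "emeasure M (C \<inter> digit_proj b S -` {\<beta>}) \<le> emeasure M (B \<union> \<rat>)"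
    proof (rule emeasure_mono)
      show "C \<inter> digit_proj b S -` {\<beta>} \<subseteq> B \<union> \<rat>" unfolding B_def by blast
      show "B \<union> \<rat> \<in> sets M" unfolding M_def using B rat by simp
    qed
    also have "\<dots> \<le> emeasure M B + emeasure M \<rat>"
      unfolding M_def using B rat by (intro emeasure_subadditive) auto
    also have "emeasure M \<rat> = 0"
      unfolding M_def using countable_rat by (intro emeasure_hausdorff_measure_countable[OF sW])
    finally have "emeasure M (C \<inter> digit_proj b S -` {\<beta>}) = 0" using null[OF False] by simp
    thus ?thesis using fib unfolding M_def C_def by (simp add: emeasure_cantor_measure)
  qed
qed

end

section \<open>Almost sure statements for product measures\<close>

lemma AE_PiM_component_notin:
  fixes M :: "'m::finite \<Rightarrow> 'a measure"
  assumes fin: "\<And>i. finite_measure (M i)" and A: "A \<in> sets (M i0)" "emeasure (M i0) A = 0"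
  shows "AE x in PiM UNIV M. x i0 \<notin> A"
proof -
  interpret product_sigma_finite M
    unfolding product_sigma_finite_def using finite_measure.axioms(1)[OF fin] by blast
  define Z where "Z = Pi\<^sub>E UNIV (\<lambda>i. if i = i0 then A else space (M i))"
  have Zs: "Z \<in> sets (PiM UNIV M)"
    unfolding Z_def using A by (intro sets_PiM_I_finite) auto
  have "emeasure (PiM UNIV M) Z = (\<Prod>i\<in>UNIV. emeasure (M i) (if i = i0 then A else space (M i)))"
    unfolding Z_def using A by (intro emeasure_PiM) auto
  also have "\<dots> = 0" using A(2) by (intro prod_zero) auto
  finally have "Z \<in> null_sets (PiM UNIV M)" using Zs by (intro null_setsI)
  moreover have "{x \<in> space (PiM UNIV M). \<not> x i0 \<notin> A} \<subseteq> Z"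
    unfolding Z_def space_PiM by (auto simp: PiE_iff)
  ultimately show ?thesis by (intro AE_I'[of Z])
qed

text \<open>With the other coordinates fixed, the equation prescribes the value of \<open>f\<close>
  at coordinate \<open>i0\<close>; the inner integral is then over part of a single fibre.\<close>

lemma AE_PiM_linear_combination_neq:
  fixes M :: "'m::finite \<Rightarrow> real measure" and f :: "real \<Rightarrow> real" and \<alpha> :: "'m \<Rightarrow> real"
  assumes fin: "\<And>i. finite_measure (M i)" and sets: "\<And>i. sets (M i) = sets borel"
    and f: "f \<in> borel_measurable borel"
    and fibre: "\<And>\<beta>. emeasure (M i0) (f -` {\<beta>}) = 0" and \<alpha>: "\<alpha> i0 \<noteq> 0"
  shows "AE x in PiM UNIV M. \<alpha>0 + (\<Sum>i\<in>UNIV. \<alpha> i * f (x i)) \<noteq> 0"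
proof -
  interpret product_sigma_finite M
    unfolding product_sigma_finite_def using finite_measure.axioms(1)[OF fin] by blast
  have sp: "space (M i) = UNIV" for i using sets_eq_imp_space_eq[OF sets] by simp
  define h where "h x = \<alpha>0 + (\<Sum>i\<in>UNIV. \<alpha> i * f (x i))" for x
  have comp: "(\<lambda>x. f (x i)) \<in> borel_measurable (PiM UNIV M)" for i
  proof -
    have "(\<lambda>x. x i) \<in> measurable (PiM UNIV M) (M i)" by (rule measurable_component_singleton) simp
    hence "(\<lambda>x. x i) \<in> measurable (PiM UNIV M) borel" using measurable_cong_sets[OF refl sets] by blast
    thus ?thesis by (rule measurable_compose[OF _ f])
  qed
  have h: "h \<in> borel_measurable (PiM UNIV M)"
    unfolding h_def using comp by (intro borel_measurable_add borel_measurable_sum borel_measurable_times) auto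
  define Z where "Z = h -` {0} \<inter> space (PiM UNIV M)"
  have Zs: "Z \<in> sets (PiM UNIV M)" unfolding Z_def by (rule measurable_sets[OF h]) simp
  define I where "I = UNIV - {i0}"
  have I: "insert i0 I = UNIV" "finite I" "i0 \<notin> I" unfolding I_def by auto
  have "emeasure (PiM UNIV M) Z = integral\<^sup>N (PiM (insert i0 I) M) (indicator Z)"
    unfolding I(1) using Zs by simp
  also have "\<dots> = (\<integral>\<^sup>+ x. (\<integral>\<^sup>+ y. indicator Z (x(i0 := y)) \<partial>(M i0)) \<partial>(PiM I M))"
    by (rule product_nn_integral_insert) (use I Zs in auto)
  also have "\<dots> = (\<integral>\<^sup>+ x. 0 \<partial>(PiM I M))"
  proof (rule nn_integral_cong)
    fix x assume "x \<in> space (PiM I M)"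
    define r where "r = \<alpha>0 + (\<Sum>i\<in>I. \<alpha> i * f (x i))"
    have "h (x(i0 := y)) = r + \<alpha> i0 * f y" for y
    proof -
      have "(\<Sum>i\<in>UNIV. \<alpha> i * f ((x(i0 := y)) i)) = (\<Sum>i\<in>insert i0 I. \<alpha> i * f ((x(i0 := y)) i))"
        using I(1) by simp
      also have "\<dots> = \<alpha> i0 * f y + (\<Sum>i\<in>I. \<alpha> i * f ((x(i0 := y)) i))"
        using I(2,3) by (subst sum.insert) auto
      also have "(\<Sum>i\<in>I. \<alpha> i * f ((x(i0 := y)) i)) = (\<Sum>i\<in>I. \<alpha> i * f (x i))"
        using I(3) by (intro sum.cong) auto
      finally show ?thesis unfolding h_def r_def by simp
    qed
    hence "indicator Z (x(i0 := y)) \<le> (indicator (f -` {- r / \<alpha> i0}) y :: ennreal)" for y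
      using \<alpha> unfolding Z_def by (auto split: split_indicator simp: field_simps add_eq_0_iff)
    hence "(\<integral>\<^sup>+ y. indicator Z (x(i0 := y)) \<partial>(M i0)) \<le> (\<integral>\<^sup>+ y. indicator (f -` {- r / \<alpha> i0}) y \<partial>(M i0))"
      by (intro nn_integral_mono) auto
    also have "\<dots> = emeasure (M i0) (f -` {- r / \<alpha> i0})"
      using measurable_sets[OF f, of "{- r / \<alpha> i0}"] sets by (intro nn_integral_indicator) simp
    also have "\<dots> = 0" by (rule fibre)
    finally show "(\<integral>\<^sup>+ y. indicator Z (x(i0 := y)) \<partial>(M i0)) = 0" by simp
  qed
  also have "\<dots> = 0" by simp
  finally have "Z \<in> null_sets (PiM UNIV M)" using Zs by (intro null_setsI)
  thus ?thesis by (rule AE_I') (auto simp: Z_def h_def)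
qed

lemma measurable_vec_lambda:
  fixes M :: "'m::finite \<Rightarrow> real measure"
  assumes sets: "\<And>i. sets (M i) = sets borel"
  shows "vec_lambda \<in> measurable (PiM UNIV M) borel"
proof (rule borel_measurable_euclidean_space[THEN iffD2], rule ballI)
  fix e :: "real ^ 'm" assume "e \<in> Basis"
  then obtain i where e: "e = axis i 1" by (auto simp: Basis_vec_def)
  have "(\<lambda>x. x i) \<in> measurable (PiM UNIV M) (M i)" by (rule measurable_component_singleton) simp
  hence "(\<lambda>x. x i) \<in> measurable (PiM UNIV M) borel" using measurable_cong_sets[OF refl sets] by blast
  thus "(\<lambda>x. vec_lambda x \<bullet> e) \<in> borel_measurable (PiM UNIV M)"
    unfolding e by (simp add: inner_axis)
qed

text \<open>Meant for a set of positions and for its complement, so that both summands of a split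
  are totally irrational. Irrational coordinates ensure that \<open>digit_proj\<close> masks the
  digits of whichever expansion was chosen.\<close>

lemma AE_cantor_prod_measure:
  fixes W :: "'m::finite \<Rightarrow> nat set"
  assumes b: "2 \<le> b" and W: "\<And>i. W i \<subseteq> {..<b}" and card: "\<And>i. 2 \<le> card (W i)"
    and S: "infinite S" "infinite (- S)"
  shows "AE x in cantor_prod_measure b W. x \<in> cantor_prod b W \<and> (\<forall>i. x $ i \<notin> \<rat>) \<and>
    totally_irrational (\<chi> i. digit_proj b S (x $ i))"
proof -
  define M where "M i = cantor_measure b (W i)" for i
  have sets: "sets (M i) = sets borel" for i
    unfolding M_def using b W card by (intro sets_cantor_measure)
  have fin: "finite_measure (M i)" for i
    unfolding M_def using b W card by (intro finite_measure_cantor_measure)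
  have ml: "vec_lambda \<in> measurable (PiM UNIV M) borel" by (rule measurable_vec_lambda[OF sets])
  have meas: "(\<lambda>x :: real ^ 'm. x $ i) \<in> borel_measurable borel" for i
    by (intro borel_measurable_continuous_onI continuous_intros)
  have Kset: "AE x in cantor_prod_measure b W. x $ i \<in> cantor_set b (W i)" for i
  proof -
    have C: "cantor_set b (W i) \<in> sets borel" using b W card by (intro cantor_set_borel)
    have "AE x in PiM UNIV M. x i \<notin> - cantor_set b (W i)"
      using C sets fin emeasure_cantor_measure_Compl[OF b W card] by (intro AE_PiM_component_notin) (auto simp: M_def)
    thus ?thesis
      unfolding cantor_prod_measure_def M_def[symmetric]
      by (subst AE_distr_iff[OF ml]) (use measurable_sets[OF meas C, of i] in \<open>auto simp: vimage_def\<close>)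
  qed
  have rat: "AE x in cantor_prod_measure b W. x $ i \<notin> \<rat>" for i
  proof -
    have rat: "(\<rat> :: real set) \<in> sets borel" by (rule Rats_borel)
    hence C: "- \<rat> \<in> sets (borel :: real measure)" by auto
    have "AE x in PiM UNIV M. x i \<notin> \<rat>"
      using rat sets fin emeasure_cantor_measure_Rats[OF b W card] by (intro AE_PiM_component_notin) (auto simp: M_def)
    thus ?thesis
      unfolding cantor_prod_measure_def M_def[symmetric]
      by (subst AE_distr_iff[OF ml]) (use measurable_sets[OF meas C, of i] in \<open>auto simp: vimage_def\<close>)
  qed
  have hyp: "AE x in cantor_prod_measure b W. (\<exists>i. snd p i \<noteq> 0) \<longrightarrow>
      (\<chi> i. digit_proj b S (x $ i)) \<notin> rat_hyperplane p" for p :: "rat \<times> ('m \<Rightarrow> rat)"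
  proof (cases "\<exists>i. snd p i \<noteq> 0")
    case True
    then obtain i0 where i0: "snd p i0 \<noteq> 0" by blast
    define h where "h x = of_rat (fst p) + (\<Sum>i\<in>UNIV. of_rat (snd p i) * digit_proj b S (x $ i))"
      for x :: "real ^ 'm"
    have h: "h \<in> borel_measurable borel"
      unfolding h_def using measurable_compose[OF meas borel_measurable_digit_proj]
      by (intro borel_measurable_add borel_measurable_sum borel_measurable_times) auto
    have "AE x in PiM UNIV M. of_rat (fst p) + (\<Sum>i\<in>UNIV. of_rat (snd p i) * digit_proj b S (x i)) \<noteq> 0"
      using fin sets borel_measurable_digit_proj
    proof (rule AE_PiM_linear_combination_neq)
      show "emeasure (M i0) (digit_proj b S -` {\<beta>}) = 0" for \<beta>
        unfolding M_def by (rule emeasure_cantor_measure_digit_proj_fibre[OF b W card S])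
    qed (use i0 in auto)
    hence "AE x in PiM UNIV M. h (vec_lambda x) \<noteq> 0" unfolding h_def by simp
    hence "AE x in cantor_prod_measure b W. h x \<noteq> 0"
      unfolding cantor_prod_measure_def M_def[symmetric]
      by (subst AE_distr_iff[OF ml]) (use measurable_sets[OF h, of "- {0}"] in \<open>auto simp: vimage_def\<close>)
    thus ?thesis by (rule AE_mp) (auto simp: rat_hyperplane_def h_def)
  qed simp
  have "AE x in cantor_prod_measure b W. \<forall>p. (\<exists>i. snd p i \<noteq> 0) \<longrightarrow>
      (\<chi> i. digit_proj b S (x $ i)) \<notin> rat_hyperplane p"
    unfolding AE_all_countable using hyp by blast
  moreover have "AE x in cantor_prod_measure b W. \<forall>i. x $ i \<in> cantor_set b (W i)"
    unfolding AE_all_countable using Kset by blast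
  moreover have "AE x in cantor_prod_measure b W. \<forall>i. x $ i \<notin> \<rat>"
    unfolding AE_all_countable using rat by blast
  ultimately show ?thesis
    unfolding totally_irrational_iff cantor_prod_def by eventually_elim auto
qed

section \<open>Singular vectors in products of Cantor sets\<close>

text \<open>The target \<open>A\<close> is kept abstract so that constant digits \<open>d i\<close>
  give the bound for \<open>sing_star\<close> and zeros the one for
  \<open>sing_base_star\<close>.\<close>

lemma packing_dim_ge_of_const_blocks:
  fixes W :: "'m::finite \<Rightarrow> nat set"
  assumes b: "2 \<le> b" and W: "\<And>i. W i \<subseteq> {..<b}" and card: "\<And>i. 2 \<le> card (W i)"
    and d: "\<And>i. d i \<in> W i" and w: "0 \<le> w" "w < 1"
    and A: "\<And>Z w' a x. block_cover Z w' \<Longrightarrow> w < w' \<Longrightarrow> (\<And>i k. a i k \<in> W i) \<Longrightarrow>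
      (\<And>i. x $ i = digit_val b (a i)) \<Longrightarrow> (\<And>i k. k \<in> Z \<Longrightarrow> a i k = d i) \<Longrightarrow>
      totally_irrational x \<Longrightarrow> x \<in> A"
  shows "ereal ((1 - w) * cantor_dim b W) \<le> packing_dim A"
proof -
  have dim: "0 < cantor_dim b W" using b card by (rule cantor_dim_pos)
  have *: "ereal (\<theta> * cantor_dim b W) \<le> packing_dim A" if \<theta>: "0 < \<theta>" "\<theta> < 1 - w" for \<theta>
  proof -
    \<comment> \<open>Midway between \<open>w\<close> and \<open>1 - \<theta>\<close>: longer blocks
      than exponent \<open>w\<close> asks for, yet more than density \<open>\<theta>\<close> remains
      free.\<close>
    define w' where "w' = (w + (1 - \<theta>)) / 2"
    have w': "0 < w'" "w' < 1" "w < w'" "\<theta> < 1 - w'" unfolding w'_def using \<theta> w by (auto simp: field_simps)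
    obtain Z where Z: "block_cover Z w'"
        "\<exists>\<^sub>F n in sequentially. \<theta> * real n \<le> real (Finite_Set.card ({..<n} - Z))"
      using ex_sparse_block_cover[OF w'(1,2)] w'(4) by blast
    have freq: "\<exists>\<^sub>F n in sequentially. \<theta> * real n \<le> real (Finite_Set.card ({..<n} \<inter> - Z))"
      using Z(2) by (simp add: Diff_eq)
    have inf: "infinite (- Z)"
    proof
      assume fin: "finite (- Z)"
      have "\<forall>\<^sub>F n in sequentially. real (Finite_Set.card (- Z)) / \<theta> < real n"
        using filterlim_real_sequentially unfolding filterlim_at_top_dense by blast
      with freq have "\<exists>\<^sub>F n in sequentially. \<theta> * real n \<le> real (Finite_Set.card ({..<n} \<inter> - Z)) \<and>
          real (Finite_Set.card (- Z)) / \<theta> < real n"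
        by (rule frequently_eventually_frequently)
      then obtain n where n: "\<theta> * real n \<le> real (Finite_Set.card ({..<n} \<inter> - Z))"
          "real (Finite_Set.card (- Z)) / \<theta> < real n"
        using frequently_ex by blast
      have "Finite_Set.card ({..<n} \<inter> - Z) \<le> Finite_Set.card (- Z)" using fin by (intro card_mono) auto
      thus False using n \<theta> by (simp add: field_simps)
    qed
    define V where "V i k = (if k \<in> - Z then W i else {d i})" for i k
    have "ereal (\<theta> * cantor_dim b W) \<le> packing_dim {x \<in> digit_prod b V. totally_irrational x}"
      by (rule packing_dim_totally_irrational[OF b W card _ _ _ freq inf])
        (use d in \<open>auto simp: V_def\<close>)
    also have "\<dots> \<le> packing_dim A"
    proof (intro packing_dim_mono subsetI)
      fix x assume "x \<in> {x \<in> digit_prod b V. totally_irrational x}"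
      hence x: "x \<in> digit_prod b V" "totally_irrational x" by auto
      obtain a where a: "\<And>i k. a i k \<in> V i k" "\<And>i. x $ i = digit_val b (a i)"
        using x(1) digit_prodE by blast
      show "x \<in> A"
      proof (rule A[OF Z(1) w'(3) _ a(2) _ x(2)])
        show "a i k \<in> W i" for i k using a(1)[of i k] d unfolding V_def by (auto split: if_splits)
        show "a i k = d i" if "k \<in> Z" for i k using a(1)[of i k] that unfolding V_def by auto
      qed
    qed
    finally show ?thesis .
  qed
  show ?thesis
  proof (rule ccontr)
    assume "\<not> ?thesis"
    hence lt: "packing_dim A < ereal ((1 - w) * cantor_dim b W)" by simp
    then obtain r where r: "packing_dim A = ereal r" "0 \<le> r"
      using packing_dim_nonneg[of A] by (cases "packing_dim A") auto
    have r1: "r / cantor_dim b W < 1 - w" using lt r dim by (simp add: field_simps)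
    define \<theta> where "\<theta> = (r / cantor_dim b W + (1 - w)) / 2"
    have "0 \<le> r / cantor_dim b W" using r dim by simp
    hence "0 < \<theta>" "\<theta> < 1 - w" "r / cantor_dim b W < \<theta>"
      unfolding \<theta>_def using r1 w by argo+
    moreover have "r < \<theta> * cantor_dim b W" using calculation(3) dim by (simp add: field_simps)
    ultimately show False using *[of \<theta>] r by simp
  qed
qed

lemma packing_dim_sing_star_ge:
  fixes W :: "'m::finite \<Rightarrow> nat set"
  assumes b: "2 \<le> b" and W: "\<And>i. W i \<subseteq> {..<b}" and card: "\<And>i. 2 \<le> card (W i)"
    and N: "is_norm N" and w: "0 \<le> w" "w < 1"
  shows "ereal ((1 - w) * cantor_dim b W) \<le> packing_dim (sing_star N w \<inter> cantor_prod b W)"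
proof (rule packing_dim_ge_of_const_blocks[OF b W card _ w])
  have "W i \<noteq> {}" for i using card[of i] by auto
  thus "(SOME d. d \<in> W i) \<in> W i" for i by (simp add: some_in_eq)
  fix Z w' a and x :: "real ^ 'm"
  assume Z: "block_cover Z w'" "w < w'" and a: "\<And>i k. a i k \<in> W i" "\<And>i. x $ i = digit_val b (a i)"
    and const: "\<And>i k. k \<in> Z \<Longrightarrow> a i k = (SOME d. d \<in> W i)" and irr: "totally_irrational x"
  have "a i k < b" for i k using a(1) W by blast
  hence "x \<in> sing N w" using sing_of_const_blocks[OF N b w(1) Z(2,1) _ a(2) const] by blast
  moreover have "x \<in> cantor_prod b W"
    unfolding cantor_prod_eq_digit_prod digit_prod_def digit_set_def using a by blast
  ultimately show "x \<in> sing_star N w \<inter> cantor_prod b W" using irr unfolding sing_star_def by simp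
qed

lemma packing_dim_sing_base_star_ge:
  fixes W :: "'m::finite \<Rightarrow> nat set"
  assumes b: "2 \<le> b" and W: "\<And>i. W i \<subseteq> {..<b}" and card: "\<And>i. 2 \<le> card (W i)"
    and N: "is_norm N" and w: "0 \<le> w" "w < 1" and zero: "\<And>i. 0 \<in> W i"
  shows "ereal ((1 - w) * cantor_dim b W) \<le> packing_dim (sing_base_star b N w \<inter> cantor_prod b W)"
proof (rule packing_dim_ge_of_const_blocks[OF b W card zero w])
  fix Z w' a and x :: "real ^ 'm"
  assume Z: "block_cover Z w'" "w < w'" and a: "\<And>i k. a i k \<in> W i" "\<And>i. x $ i = digit_val b (a i)"
    and const: "\<And>i k. k \<in> Z \<Longrightarrow> a i k = 0" and irr: "totally_irrational x"
  have "a i k < b" for i k using a(1) W by blast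
  hence "x \<in> sing_base b N w" using sing_base_of_zero_blocks[OF N b w(1) Z(2,1) _ a(2) const] by blast
  moreover have "x \<in> cantor_prod b W"
    unfolding cantor_prod_eq_digit_prod digit_prod_def digit_set_def using a by blast
  ultimately show "x \<in> sing_base_star b N w \<inter> cantor_prod b W"
    using irr unfolding sing_base_star_def by simp
qed

section \<open>Splitting digits between two summands\<close>

lemma cut_digits_in_sing_base:
  fixes W :: "'m::finite \<Rightarrow> nat set"
  assumes b: "2 \<le> b" and W: "\<And>i. W i \<subseteq> {..<b}" and N: "is_norm N" and zero: "\<And>i. 0 \<in> W i"
    and a: "\<And>i k. a i k \<in> W i" and w: "0 \<le> w" "w < w'" and Z: "block_cover (- S) w'"
  shows "(\<chi> i. digit_val b (\<lambda>k. if k \<in> S then a i k else 0)) \<in> sing_base b N w \<inter> cantor_prod b W"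
proof
  show "(\<chi> i. digit_val b (\<lambda>k. if k \<in> S then a i k else 0)) \<in> sing_base b N w"
  proof (rule sing_base_of_zero_blocks[OF N b w Z])
    show "(if k \<in> S then a i k else 0) < b" for i k using a[of i k] zero[of i] W by auto
  qed auto
  show "(\<chi> i. digit_val b (\<lambda>k. if k \<in> S then a i k else 0)) \<in> cantor_prod b W"
    unfolding cantor_prod_eq_digit_prod using a zero by (intro digit_prodI) auto
qed

lemma cut_digits_add:
  fixes x :: "real ^ 'm::finite"
  assumes b: "2 \<le> b" and a: "\<And>i k. a i k < b" and x: "\<And>i. x $ i = digit_val b (a i)"
  shows "x = (\<chi> i. digit_val b (\<lambda>k. if k \<in> - Z then a i k else 0)) +
    (\<chi> i. digit_val b (\<lambda>k. if k \<in> Z then a i k else 0))"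
proof -
  have "digit_val b (\<lambda>k. if k \<in> - Z then a i k else 0) + digit_val b (\<lambda>k. if k \<in> Z then a i k else 0) =
      digit_val b (a i)" for i
    using a[of i] b by (subst digit_val_add) (auto intro!: arg_cong[of _ _ "digit_val b"])
  thus ?thesis using x by (simp add: vec_eq_iff)
qed

context
  fixes b :: nat and W :: "'m::finite \<Rightarrow> nat set" and N :: "real ^ 'm \<Rightarrow> real" and w w0 w1 :: real
  assumes b: "2 \<le> b" and W: "\<And>i. W i \<subseteq> {..<b}" and card: "\<And>i. 2 \<le> card (W i)"
    and N: "is_norm N" and zero: "\<And>i. 0 \<in> W i"
    and w: "0 < w" "w < 1" and w0: "0 \<le> w0" "w0 < w" and w1: "0 \<le> w1" "w1 < (1 - sqrt w)\<^sup>2"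
begin

text \<open>The exponents are midpoints, since the singularity criterion needs blocks strictly
  longer than the exponent it delivers.\<close>

lemma ex_split_blocks:
  obtains Z w0' w1' where "block_cover Z w0'" "w0 < w0'" "block_cover (- Z) w1'" "w1 < w1'"
    "infinite Z" "infinite (- Z)"
proof -
  define w0' where "w0' = (w0 + w) / 2"
  define w1' where "w1' = (w1 + (1 - sqrt w)\<^sup>2) / 2"
  have w': "0 \<le> w0'" "w0' < w" "0 \<le> w1'" "w1' < (1 - sqrt w)\<^sup>2" "w0 < w0'" "w1 < w1'"
    unfolding w0'_def w1'_def using w0 w1 by auto
  obtain Z where Z: "block_cover Z w0'" "block_cover (- Z) w1'"
    using ex_complementary_block_covers[OF w w'(1-4)] by blast
  moreover have "infinite Z" "infinite (- Z)"
    using block_cover_infinite[OF Z(1)] block_cover_infinite[OF Z(2)] w' w0(1) w1(1) by linarith+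
  ultimately show ?thesis using that w' by blast
qed

lemma cantor_prod_subset_sum_sing_base:
  "cantor_prod b W \<subseteq> (sing_base b N w0 \<inter> cantor_prod b W) + (sing_base b N w1 \<inter> cantor_prod b W)"
proof
  fix x assume "x \<in> cantor_prod b W"
  then obtain a where a: "\<And>i k. a i k \<in> W i" "\<And>i. x $ i = digit_val b (a i)"
    unfolding cantor_prod_eq_digit_prod using digit_prodE by blast
  obtain Z w0' w1' where Z: "block_cover Z w0'" "w0 < w0'" "block_cover (- Z) w1'" "w1 < w1'"
    by (rule ex_split_blocks)
  have ab: "a i k < b" for i k using a(1) W by blast
  show "x \<in> (sing_base b N w0 \<inter> cantor_prod b W) + (sing_base b N w1 \<inter> cantor_prod b W)"
  proof (subst cut_digits_add[where Z = Z, OF b ab a(2)], rule set_plus_intro)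
    \<comment> \<open>The roles cross: keeping the digits off \<open>Z\<close> makes
      \<open>Z\<close> the zero set, hence the exponent \<open>w0\<close> of
      \<open>Z\<close>.\<close>
    show "(\<chi> i. digit_val b (\<lambda>k. if k \<in> - Z then a i k else 0)) \<in> sing_base b N w0 \<inter> cantor_prod b W"
      using Z(1) by (intro cut_digits_in_sing_base[OF b W N zero a(1) w0(1) Z(2)]) simp
    show "(\<chi> i. digit_val b (\<lambda>k. if k \<in> Z then a i k else 0)) \<in> sing_base b N w1 \<inter> cantor_prod b W"
      by (rule cut_digits_in_sing_base[OF b W N zero a(1) w1(1) Z(4,3)])
  qed
qed

lemma AE_in_sum_sing_base_star:
  "AE x in cantor_prod_measure b W. x \<in> ((sing_base_star b N w0 \<inter> cantor_prod b W) +
     (sing_base_star b N w1 \<inter> cantor_prod b W)) \<inter> cantor_prod b W"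
proof -
  obtain Z w0' w1' where Z: "block_cover Z w0'" "w0 < w0'" "block_cover (- Z) w1'" "w1 < w1'"
      "infinite Z" "infinite (- Z)"
    by (rule ex_split_blocks)
  have inf: "infinite (- (- Z))" using Z(5) by simp
  show ?thesis
    using AE_cantor_prod_measure[OF b W card Z(5,6)] AE_cantor_prod_measure[OF b W card Z(6) inf]
  proof eventually_elim
    case (elim x)
    hence "x \<in> cantor_prod b W" by simp
    then obtain a where a: "\<And>i k. a i k \<in> W i" "\<And>i. x $ i = digit_val b (a i)"
      unfolding cantor_prod_eq_digit_prod using digit_prodE by blast
    have ab: "a i k < b" for i k using a(1) W by blast
    have irr: "digit_val b (a i) \<notin> \<rat>" for i using elim a(2) by metis
    define y where "y S = (\<chi> i. digit_val b (\<lambda>k. if k \<in> S then a i k else 0))" for S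
    have y: "y S = (\<chi> i. digit_proj b S (x $ i))" for S
      unfolding y_def a(2) using digit_proj_digit_val[OF b ab irr] by simp
    have "totally_irrational (y Z)" "totally_irrational (y (- Z))" unfolding y using elim by auto
    moreover have "y (- Z) \<in> sing_base b N w0 \<inter> cantor_prod b W"
      unfolding y_def using cut_digits_in_sing_base[OF b W N zero a(1) w0(1) Z(2), of "- Z"] Z(1) by simp
    moreover have "y Z \<in> sing_base b N w1 \<inter> cantor_prod b W"
      unfolding y_def using cut_digits_in_sing_base[OF b W N zero a(1) w1(1) Z(4), of Z] Z(3) by simp
    moreover have "x = y (- Z) + y Z" unfolding y_def by (rule cut_digits_add[OF b ab a(2)])
    ultimately show ?case
      using \<open>x \<in> cantor_prod b W\<close> unfolding sing_base_star_def by (auto intro!: set_plus_intro)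
  qed
qed

end

lemma sing_base_star_subset_sing_star:
  "2 \<le> b \<Longrightarrow> sing_base_star b N w \<subseteq> sing_star N w"
  unfolding sing_base_star_def sing_star_def using sing_base_subset_sing by blast

theorem theorem4p1:
  fixes b :: nat and W :: "'m::finite \<Rightarrow> nat set" and K :: "(real ^ 'm) set"
    and N :: "real ^ 'm \<Rightarrow> real"
  assumes "b \<ge> 2"
    and "\<And>i. W i \<subseteq> {0..b - 1}"
    and "\<And>i. card (W i) \<ge> 2"
    and "K = cantor_prod b W"
    and "is_norm N"
  shows
    "((\<forall>i. 0 \<in> W i) \<longrightarrow>
        (\<forall>w::real. 0 \<le> w \<and> w < 1 \<longrightarrow>
           packing_dim (sing_star N w \<inter> K) \<ge> packing_dim (sing_base_star b N w \<inter> K) \<and>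
           packing_dim (sing_base_star b N w \<inter> K) \<ge> ereal (1 - w) * hausdorff_dim K \<and>
           ereal (1 - w) * hausdorff_dim K
             = ereal ((1 - w) * ((\<Sum>i\<in>UNIV. ln (real (card (W i)))) / ln (real b))) \<and>
           (1 - w) * ((\<Sum>i\<in>UNIV. ln (real (card (W i)))) / ln (real b)) > 0) \<and>
        packing_dim (sing_star N (1 / real CARD('m)) \<inter> K)
          \<ge> packing_dim (sing_base_star b N (1 / real CARD('m)) \<inter> K) \<and>
        packing_dim (sing_base_star b N (1 / real CARD('m)) \<inter> K)
          \<ge> ereal ((1 - 1 / real CARD('m)) * ((\<Sum>i\<in>UNIV. ln (real (card (W i)))) / ln (real b))))
     \<and>
     (hausdorff_dim K = ereal ((\<Sum>i\<in>UNIV. ln (real (card (W i)))) / ln (real b)) \<and>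
      (\<forall>w::real. 0 \<le> w \<and> w < 1 \<longrightarrow>
         packing_dim (sing_star N w \<inter> K) \<ge> ereal (1 - w) * hausdorff_dim K \<and>
         ereal (1 - w) * hausdorff_dim K > 0))
     \<and>
     ((\<forall>i. 0 \<in> W i) \<longrightarrow>
        (\<forall>w w0 w1 :: real. 0 < w \<and> w < 1 \<and> 0 \<le> w0 \<and> w0 < w \<and> 0 \<le> w1 \<and> w1 < (1 - sqrt w)\<^sup>2 \<longrightarrow>
           (AE x in cantor_prod_measure b W.
              x \<in> ((sing_star N w0 \<inter> K) + (sing_star N w1 \<inter> K)) \<inter> K) \<and>
           (AE x in cantor_prod_measure b W.
              x \<in> ((sing_base_star b N w0 \<inter> K) + (sing_base_star b N w1 \<inter> K)) \<inter> K) \<and>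
           (sing_base b N w0 \<inter> K) + (sing_base b N w1 \<inter> K) \<subseteq> (sing N w0 \<inter> K) + (sing N w1 \<inter> K) \<and>
           K \<subseteq> (sing_base b N w0 \<inter> K) + (sing_base b N w1 \<inter> K)))"
proof -
  note b = \<open>2 \<le> b\<close> and card = \<open>\<And>i. card (W i) \<ge> 2\<close> and K = \<open>K = cantor_prod b W\<close> and N = \<open>is_norm N\<close>
  have W: "W i \<subseteq> {..<b}" for i
  proof -
    have "{0..b - 1} = {..<b}" using b by auto
    thus ?thesis using assms(2)[of i] by simp
  qed
  have dim: "(\<Sum>i\<in>UNIV. ln (real (card (W i)))) / ln (real b) = cantor_dim b W"
    unfolding cantor_dim_def ..
  have dim_pos: "0 < cantor_dim b W" using b card by (rule cantor_dim_pos)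
  have hd: "hausdorff_dim K = ereal (cantor_dim b W)"
    unfolding K by (rule hausdorff_dim_cantor_prod[OF b W card])
  have mono: "packing_dim (sing_base_star b N w \<inter> K) \<le> packing_dim (sing_star N w \<inter> K)" for w
    using sing_base_star_subset_sing_star[OF b] by (intro packing_dim_mono) blast
  have star: "ereal ((1 - w) * cantor_dim b W) \<le> packing_dim (sing_star N w \<inter> K)"
    if "0 \<le> w" "w < 1" for w
    unfolding K by (rule packing_dim_sing_star_ge[OF b W card N that])
  have base_star: "ereal ((1 - w) * cantor_dim b W) \<le> packing_dim (sing_base_star b N w \<inter> K)"
    if "\<forall>i. 0 \<in> W i" "0 \<le> w" "w \<le> 1" for w
  \<comment> \<open>The value 1 occurs as the exponent \<open>1 / m\<close> in dimension
    \<open>m = 1\<close>, where the claimed bound is 0.\<close>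
  proof (cases "w = 1")
    case True
    thus ?thesis using packing_dim_nonneg[of "sing_base_star b N w \<inter> K"] by (simp add: zero_ereal_def)
  next
    case False
    thus ?thesis unfolding K using that by (intro packing_dim_sing_base_star_ge[OF b W card N]) auto
  qed
  have inv_card: "0 \<le> 1 / real CARD('m)" "1 / real CARD('m) \<le> 1" by auto
  have AE_base: "AE x in cantor_prod_measure b W.
      x \<in> ((sing_base_star b N w0 \<inter> K) + (sing_base_star b N w1 \<inter> K)) \<inter> K"
    if "\<forall>i. 0 \<in> W i" "0 < w" "w < 1" "0 \<le> w0" "w0 < w" "0 \<le> w1" "w1 < (1 - sqrt w)\<^sup>2" for w w0 w1
    unfolding K
    by (rule AE_in_sum_sing_base_star[where W = W, OF b W card N _ that(2-7)]) (use that(1) in blast)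
  have AE_star: "AE x in cantor_prod_measure b W. x \<in> ((sing_star N w0 \<inter> K) + (sing_star N w1 \<inter> K)) \<inter> K"
    if "\<forall>i. 0 \<in> W i" "0 < w" "w < 1" "0 \<le> w0" "w0 < w" "0 \<le> w1" "w1 < (1 - sqrt w)\<^sup>2" for w w0 w1
  proof -
    have "(sing_base_star b N w0 \<inter> K) + (sing_base_star b N w1 \<inter> K) \<subseteq>
        (sing_star N w0 \<inter> K) + (sing_star N w1 \<inter> K)"
      using sing_base_star_subset_sing_star[OF b] by (intro set_plus_mono2) blast+
    thus ?thesis using AE_base[OF that] by (auto elim!: eventually_mono)
  qed
  have sums: "(sing_base b N w0 \<inter> K) + (sing_base b N w1 \<inter> K) \<subseteq> (sing N w0 \<inter> K) + (sing N w1 \<inter> K)" for w0 w1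
    using sing_base_subset_sing[OF b] by (intro set_plus_mono2) blast+
  have K_sub: "K \<subseteq> (sing_base b N w0 \<inter> K) + (sing_base b N w1 \<inter> K)"
    if "\<forall>i. 0 \<in> W i" "0 < w" "w < 1" "0 \<le> w0" "w0 < w" "0 \<le> w1" "w1 < (1 - sqrt w)\<^sup>2" for w w0 w1
    unfolding K
    by (rule cantor_prod_subset_sum_sing_base[where W = W, OF b W card N _ that(2-7)])
      (use that(1) in blast)
  have sums_part: "(AE x in cantor_prod_measure b W. x \<in> ((sing_star N w0 \<inter> K) + (sing_star N w1 \<inter> K)) \<inter> K) \<and>
      (AE x in cantor_prod_measure b W.
         x \<in> ((sing_base_star b N w0 \<inter> K) + (sing_base_star b N w1 \<inter> K)) \<inter> K) \<and>
      (sing_base b N w0 \<inter> K) + (sing_base b N w1 \<inter> K) \<subseteq> (sing N w0 \<inter> K) + (sing N w1 \<inter> K) \<and>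
      K \<subseteq> (sing_base b N w0 \<inter> K) + (sing_base b N w1 \<inter> K)"
    if "\<forall>i. 0 \<in> W i" "0 < w \<and> w < 1 \<and> 0 \<le> w0 \<and> w0 < w \<and> 0 \<le> w1 \<and> w1 < (1 - sqrt w)\<^sup>2" for w w0 w1
  proof -
    from that(2) have "0 < w" "w < 1" "0 \<le> w0" "w0 < w" "0 \<le> w1" "w1 < (1 - sqrt w)\<^sup>2" by auto
    note h = that(1) this
    show ?thesis by (intro conjI AE_star[OF h] AE_base[OF h] sums K_sub[OF h])
  qed
  have dims: "ereal (1 - w) * ereal (cantor_dim b W) = ereal ((1 - w) * cantor_dim b W)" for w by simp
  have pos: "0 < (1 - w) * cantor_dim b W" if "w < 1" for w using that dim_pos by simp
  show ?thesis
    unfolding dim hd dims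
  proof (rule conjI, goal_cases)
    case 1
    show ?case using mono base_star inv_card pos by auto
  next
    case 2
    show ?case
    proof (rule conjI, goal_cases)
      case 1
      show ?case using star pos by simp
    next
      case 2
      show ?case by (intro impI allI, (rule sums_part; assumption))
    qed
  qed
qed

end
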